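(* Let $n=1$, $T_{\mathrm{s}}>0$ and $c>0$. Let $\partial\Gamma(0)=\{(q,p)\in\mathbb{R}^2: H(q,p)=c\}$ be an energy level set, regarded as a positively oriented (counter-clockwise) closed contour enclosing signed area $A(0)$. Let $A(T_{\mathrm{s}})$ be the signed area enclosed by the contour obtained by transporting $\partial\Gamma(0)$ for time $T_{\mathrm{s}}$ with the flow of the continuous-time dynamics $$\dot q(t)=p(t),\qquad \dot p(t)=-\frac1L\nabla f(q(t))+f_{\mathrm{NP}}(q(t),p(t)),$$ and let $A_1$ be the signed area enclosed by the image of $\partial\Gamma(0)$ under one step of the discretized dynamics $$p_{1}=p_0+T_{\mathrm{s}}\Big(-\frac1L\nabla f(q_0)+f_{\mathrm{NP}}(q_0,p_0)\Big),\qquad q_{1}=q_0+T_{\mathrm{s}}\,p_{1}.$$ Then the contraction of the signed area with the discretized dynamics is larger than the contraction with the continuous-time dynamics over one time step: $$A(0)-A_1> A(0)-A(T_{\mathrm{s}}).$$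
   Context: Standing assumptions (with $n=1$): $f:\mathbb{R}\to\mathbb{R}$ is differentiable, its derivative $\nabla f=f'$ is Lipschitz continuous with constant $L>0$, and $f$ is strongly convex with condition number $\kappa\ge1$, i.e. $f(x)\ge f(\bar x)+\nabla f(\bar x)(x-\bar x)+\frac{L}{2\kappa}|x-\bar x|^2$ for all $x,\bar x$; $f$ attains its minimum at $0$ and $f(0)=0$. Constants: $d=\frac{1}{\sqrt\kappa+1}$, $\beta=\frac{\sqrt\kappa-1}{\sqrt\kappa+1}$. Non-potential forces: $f_{\mathrm{NP}}(q,p)=-2dp-\frac1L(\nabla f(q+\beta p)-\nabla f(q))$. Total energy: $H(q,p)=\frac12|p|^2+\frac1L f(q)$. Signed area: for a closed oriented contour in the $(q,p)$-plane, the signed area enclosed is the integral of $\mathrm{d}q\wedge\mathrm{d}p$ over the enclosed region, positive for counter-clockwise orientation and negative for clockwise orientation; equivalently it is the line integral $\oint q\,\mathrm{d}p$ along the contour. Image contours carry the orientation induced by the map, and for an image contour that is not simple the signed area is understood as this line integral. *)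

theory Defs
  imports "HOL-Analysis.Analysis" "HOL-Complex_Analysis.Winding_Numbers"
begin

text \<open>
  The line integral of \<open>q dp\<close> along a contour \<open>\<gamma> :: real \<Rightarrow> real \<times> real\<close> parametrized over \<open>{0..1}\<close>,
  with \<open>q = fst \<circ> \<gamma>\<close> and \<open>p = snd \<circ> \<gamma>\<close>, as a Stieltjes integral: it is the limit of the sums of
  \<open>q(s) (p(b) - p(a))\<close> over tagged divisions into intervals \<open>{a..b} \<ni> s\<close>.  Since \<open>deriv f\<close> is only
  Lipschitz, the transported contours need not be differentiable everywhere; they are rectifiable,
  and this is the usual line integral along a rectifiable curve.  If the limit does not exist, the
  value is unspecified.  Lemma \<open>signed_area_eq_integral\<close> relates it to the integral of \<open>q(s) p'(s)\<close>.
\<close>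

definition signed_area :: "(real \<Rightarrow> real \<times> real) \<Rightarrow> real" where
  "signed_area \<gamma> = Lim (division_filter {0..1})
     (\<lambda>D. \<Sum>(s, K)\<in>D. fst (\<gamma> s) * (snd (\<gamma> (Sup K)) - snd (\<gamma> (Inf K))))"

lemma signed_area_eq_integral:
  assumes p': "\<And>s. s \<in> {0..1} \<Longrightarrow>
      ((\<lambda>s. snd (\<gamma> s)) has_real_derivative p' s) (at s within {0..1})"
    and I: "((\<lambda>s. fst (\<gamma> s) * p' s) has_integral I) {0..1}"
  shows "signed_area \<gamma> = I"
proof -
  let ?S = "\<lambda>D. \<Sum>(s, K)\<in>D. fst (\<gamma> s) * (snd (\<gamma> (Sup K)) - snd (\<gamma> (Inf K)))"
  let ?R = "\<lambda>D. \<Sum>(s, K)\<in>D. measure lborel K *\<^sub>R (fst (\<gamma> s) * p' s)"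
  let ?F = "division_filter {0..1::real}"
  have R: "(?R \<longlongrightarrow> I) ?F"
    using I has_integral_cbox[of "\<lambda>s. fst (\<gamma> s) * p' s" I 0 1] by simp
  have "((\<lambda>D. ?S D - ?R D) \<longlongrightarrow> 0) ?F"
  proof (rule tendstoI)
    fix e :: real assume e: "e > 0"
    define \<epsilon> where "\<epsilon> s = e / 2 / (\<bar>fst (\<gamma> s)\<bar> + 1)" for s
    have \<epsilon>: "\<epsilon> s > 0" for s using e by (simp add: \<epsilon>_def)
    have "\<exists>\<delta>>0. s \<in> {0..1} \<longrightarrow> (\<forall>y\<in>{0..1}. \<bar>y - s\<bar> < \<delta> \<longrightarrow>
        \<bar>snd (\<gamma> y) - snd (\<gamma> s) - p' s * (y - s)\<bar> \<le> \<epsilon> s * \<bar>y - s\<bar>)" for s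
    proof (cases "s \<in> {0..1}")
      case True
      then show ?thesis
        using p'[OF True] \<epsilon>[of s]
        unfolding has_field_derivative_def has_derivative_within_alt by auto
    qed (auto intro: exI[of _ 1])
    then obtain \<delta> where \<delta>: "\<And>s. \<delta> s > 0"
      and lin: "\<And>s y. \<lbrakk>s \<in> {0..1}; y \<in> {0..1}; \<bar>y - s\<bar> < \<delta> s\<rbrakk> \<Longrightarrow>
        \<bar>snd (\<gamma> y) - snd (\<gamma> s) - p' s * (y - s)\<bar> \<le> \<epsilon> s * \<bar>y - s\<bar>"
      by metis
    have "dist (?S D - ?R D) 0 < e"
      if D: "D tagged_division_of {0..1}" and fine: "(\<lambda>s. ball s (\<delta> s)) fine D" for D
    proof -
      have fin: "finite D" using D by auto
      have "\<bar>fst (\<gamma> s) * (snd (\<gamma> (Sup K)) - snd (\<gamma> (Inf K))) - measure lborel K *\<^sub>R (fst (\<gamma> s) * p' s)\<bar>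
          \<le> e / 2 * measure lborel K" if sK: "(s, K) \<in> D" for s K
      proof -
        obtain a b where "K = cbox a b" using tagged_division_ofD(4)[OF D sK] by blast
        moreover have s: "s \<in> K" using tagged_division_ofD(2)[OF D sK] .
        ultimately have K: "K = {a..b}" "a \<le> s" "s \<le> b" by auto
        have sub: "K \<subseteq> {0..1}" using tagged_division_ofD(3)[OF D sK] .
        have "K \<subseteq> ball s (\<delta> s)" using fine sK by (auto simp: fine_def)
        moreover have "a \<in> K" "b \<in> K" using K by auto
        ultimately have "\<bar>a - s\<bar> < \<delta> s" "\<bar>b - s\<bar> < \<delta> s"
          by (auto simp: subset_iff dist_real_def abs_minus_commute)
        moreover have "a \<in> {0..1}" "b \<in> {0..1}" "s \<in> {0..1}" using sub K by auto
        ultimately have "\<bar>snd (\<gamma> a) - snd (\<gamma> s) - p' s * (a - s)\<bar> \<le> \<epsilon> s * \<bar>a - s\<bar>"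
          "\<bar>snd (\<gamma> b) - snd (\<gamma> s) - p' s * (b - s)\<bar> \<le> \<epsilon> s * \<bar>b - s\<bar>"
          using lin by blast+
        then have "\<bar>snd (\<gamma> a) - snd (\<gamma> s) - p' s * (a - s)\<bar> \<le> \<epsilon> s * (s - a)"
          "\<bar>snd (\<gamma> b) - snd (\<gamma> s) - p' s * (b - s)\<bar> \<le> \<epsilon> s * (b - s)"
          using K by auto
        then have "\<bar>snd (\<gamma> b) - snd (\<gamma> a) - p' s * (b - a)\<bar> \<le> \<epsilon> s * (b - a)"
          by (simp add: algebra_simps abs_le_iff)
        then have "\<bar>fst (\<gamma> s)\<bar> * \<bar>snd (\<gamma> b) - snd (\<gamma> a) - p' s * (b - a)\<bar>
            \<le> \<bar>fst (\<gamma> s)\<bar> * (\<epsilon> s * (b - a))"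
          by (rule mult_left_mono) simp
        also have "\<dots> = (\<bar>fst (\<gamma> s)\<bar> * \<epsilon> s) * (b - a)" by simp
        also have "\<dots> \<le> e / 2 * (b - a)"
        proof (rule mult_right_mono)
          show "\<bar>fst (\<gamma> s)\<bar> * \<epsilon> s \<le> e / 2"
            using e by (simp add: \<epsilon>_def field_simps)
        qed (use K in simp)
        finally show ?thesis
          using K by (simp add: abs_mult[symmetric] algebra_simps)
      qed
      then have "\<bar>?S D - ?R D\<bar> \<le> (\<Sum>(s, K)\<in>D. e / 2 * measure lborel K)"
        unfolding sum_subtractf[symmetric]
        by (intro order.trans[OF sum_abs] sum_mono) (auto simp: split_def)
      also have "\<dots> = e / 2 * (\<Sum>(s, K)\<in>D. measure lborel K)"
        by (simp add: sum_distrib_left split_def)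
      also have "(\<Sum>(s, K)\<in>D. measure lborel K) = 1"
        using additive_content_tagged_division[of D 0 "1::real"] D by simp
      finally show ?thesis using e by simp
    qed
    then show "\<forall>\<^sub>F D in ?F. dist (?S D - ?R D) 0 < e"
      unfolding eventually_division_filter
      by (intro exI[of _ "\<lambda>s. ball s (\<delta> s)"]) (auto simp: gauge_def \<delta>)
  qed
  from tendsto_add[OF this R] have "(?S \<longlongrightarrow> I) ?F" by simp
  moreover have "?F \<noteq> bot" using division_filter_not_empty[of 0 "1::real"] by simp
  ultimately show ?thesis
    unfolding signed_area_def by (rule tendsto_Lim[rotated])
qed

text \<open>The plane is identified with \<open>complex\<close> via \<open>(q, p) \<mapsto> q + i p\<close>.\<close>

definition complex_contour :: "(real \<Rightarrow> real \<times> real) \<Rightarrow> real \<Rightarrow> complex" where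
  "complex_contour \<gamma> s = Complex (fst (\<gamma> s)) (snd (\<gamma> s))"

definition counterclockwise :: "(real \<Rightarrow> real \<times> real) \<Rightarrow> bool" where
  "counterclockwise \<gamma> \<longleftrightarrow>
     (\<forall>z \<in> inside (path_image (complex_contour \<gamma>)). winding_number (complex_contour \<gamma>) z = 1)"

definition positively_oriented_contour :: "(real \<times> real) set \<Rightarrow> (real \<Rightarrow> real \<times> real) \<Rightarrow> bool" where
  "positively_oriented_contour C \<gamma> \<longleftrightarrow>
     simple_path \<gamma> \<and> pathfinish \<gamma> = pathstart \<gamma> \<and> path_image \<gamma> = C \<and> counterclockwise \<gamma>"

definition damping :: "real \<Rightarrow> real" where
  "damping \<kappa> = 1 / (sqrt \<kappa> + 1)"

definition momentum :: "real \<Rightarrow> real" where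
  "momentum \<kappa> = (sqrt \<kappa> - 1) / (sqrt \<kappa> + 1)"

definition f_NP :: "(real \<Rightarrow> real) \<Rightarrow> real \<Rightarrow> real \<Rightarrow> real \<Rightarrow> real \<Rightarrow> real" where
  "f_NP f L \<kappa> q p =
     - 2 * damping \<kappa> * p - 1 / L * (deriv f (q + momentum \<kappa> * p) - deriv f q)"

definition energy :: "(real \<Rightarrow> real) \<Rightarrow> real \<Rightarrow> real \<Rightarrow> real \<Rightarrow> real" where
  "energy f L q p = 1 / 2 * \<bar>p\<bar>\<^sup>2 + 1 / L * f q"

definition dynamics :: "(real \<Rightarrow> real) \<Rightarrow> real \<Rightarrow> real \<Rightarrow> real \<times> real \<Rightarrow> real \<times> real" where
  "dynamics f L \<kappa> = (\<lambda>(q, p). (p, - 1 / L * deriv f q + f_NP f L \<kappa> q p))"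

definition discrete_step ::
    "(real \<Rightarrow> real) \<Rightarrow> real \<Rightarrow> real \<Rightarrow> real \<Rightarrow> real \<times> real \<Rightarrow> real \<times> real" where
  "discrete_step f L \<kappa> Ts = (\<lambda>(q0, p0).
     let p1 = p0 + Ts * (- 1 / L * deriv f q0 + f_NP f L \<kappa> q0 p0);
         q1 = q0 + Ts * p1
     in (q1, p1))"

text \<open>\<open>\<phi> t z\<close> is the value at time \<open>t \<ge> 0\<close> of a solution of \<open>x' = F(x)\<close>, \<open>x(0) = z\<close>;
  for the globally Lipschitz fields considered here it exists and is unique.\<close>

definition forward_flow :: "('a::real_normed_vector \<Rightarrow> 'a) \<Rightarrow> (real \<Rightarrow> 'a \<Rightarrow> 'a) \<Rightarrow> bool" where
  "forward_flow F \<phi> \<longleftrightarrow> (\<forall>z. \<phi> 0 z = z \<and>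
     (\<forall>t\<ge>0. ((\<lambda>t. \<phi> t z) has_vector_derivative F (\<phi> t z)) (at t within {0..})))"

end

theory Submission
  imports Defs "HOL-Complex_Analysis.Riemann_Mapping"
begin

text \<open>
  Write \<open>h = f'/L\<close> and \<open>u = q + \<beta> p\<close>.  The second component of the vector field is
  \<open>- 2 d p - h u\<close>: the term \<open>- h q\<close> of the potential force cancels against the non-potential force.
  Let \<open>A(t)\<close> be the line integral of \<open>q dp\<close> and \<open>B(t)\<close> that of \<open>h u dp\<close> along the level set
  transported for time \<open>t\<close>.  Since \<open>p dp\<close> and \<open>h u du\<close> are exact, both area balances involve the
  same expression (\<open>line_integral_force\<close>):

    \<^item> the flow satisfies \<open>A' = - (2 d A + \<beta> B)\<close>;

    \<^item> the discrete step produces exactly the area \<open>A(0) - T\<^sub>s (2 d A(0) + \<beta> B(0))\<close>, the Euler step for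
      this equation (\<open>signed_area_euler_step\<close>).

  The claim therefore reduces to \<open>B(t) \<le> B(0)\<close>: the differential inequality
  \<open>A' \<ge> - 2 d A - \<beta> B(0)\<close> then keeps \<open>A\<close> above an exponential, which lies strictly above its tangent at
  time zero because \<open>A(0) > 0\<close> and \<open>B(0) \<ge> 0\<close> (\<open>area_contraction\<close>).

  Geometrically, \<open>B(t)\<close> is the area enclosed by the image of the transported level set under the
  homeomorphism \<open>(q, p) \<mapsto> (h u, p)\<close>, and the energy decreases along the flow, so the region enclosed at
  time \<open>t\<close> lies inside the region enclosed at time zero.  To turn this into a proof for curves that are
  merely Lipschitz, the line integral is written as the integral of the winding number over the plane
  (\<open>line_integral_eq_winding_integral\<close>), and the winding numbers are compared pointwise
  (\<open>sheared_area_le\<close>).  About a point outside the initial region the two curves have the same winding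
  number, because the transport is a homotopy that never meets the point; about a point inside, the initial
  curve has winding number 1, and a simple closed curve can never have more.

  The contour is given with an arbitrary continuous parametrization.  The polar angle along it
  provides a Lipschitz parametrization of the level set, from which the given one arises by a monotone
  change of parameter (\<open>polar_reparametrization\<close>), and Stieltjes integrals are invariant under such
  a change (\<open>signed_area_reparametrized\<close>).
\<close>

section \<open>Stieltjes integrals of Lipschitz functions\<close>

text \<open>
  On an interval of length \<open>b - a\<close> the integrand differs from \<open>X s\<close> by at most \<open>M (b - a)\<close>, and the
  interval has measure \<open>G b - G a\<close>.
\<close>

lemma interval_measure_integral_approx:
  fixes X G :: "real \<Rightarrow> real"
  assumes X: "M-lipschitz_on UNIV X" and bdd: "\<And>x. \<bar>X x\<bar> \<le> B"
    and G: "mono G" "continuous_on UNIV G"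
  defines "I \<equiv> \<lambda>x. LINT s:{0<..x}|interval_measure G. X s"
  assumes "0 \<le> a" "a \<le> s" "s \<le> b"
  shows "\<bar>I b - I a - X s * (G b - G a)\<bar> \<le> M * (b - a) * (G b - G a)"
proof -
  let ?\<mu> = "interval_measure G"
  have ab: "a \<le> b" using assms by simp
  have G': "\<And>x y. x \<le> y \<Longrightarrow> G x \<le> G y" "\<And>x. continuous (at_right x) G"
    using G by (auto simp: mono_def continuous_on_eq_continuous_at intro: continuous_at_imp_continuous_at_within)
  have em: "emeasure ?\<mu> {x<..y} = ennreal (G y - G x)" if "x \<le> y" for x y
    using that G' by (simp add: emeasure_interval_measure_Ioc)
  have me: "measure ?\<mu> {x<..y} = G y - G x" if "x \<le> y" for x y
    using that G' by (simp add: measure_interval_measure_Ioc)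
  have Xm: "X \<in> borel_measurable borel"
    using lipschitz_on_continuous_on[OF X] by (simp add: borel_measurable_continuous_onI)
  have int: "set_integrable ?\<mu> {x<..y} f"
    if "x \<le> y" "f \<in> borel_measurable borel" "\<And>x. \<bar>f x\<bar> \<le> C" for x y C and f :: "real \<Rightarrow> real"
    unfolding set_integrable_def real_scaleR_def
  proof (rule Bochner_Integration.integrable_bound[of _ "\<lambda>x'. C * indicator {x<..y} x'"])
    show "integrable ?\<mu> (\<lambda>x'. C * indicator {x<..y} x')"
      using that by (intro integrable_mult_right integrable_real_indicator) (auto simp: em)
    show "(\<lambda>x'. indicator {x<..y} x' * f x') \<in> borel_measurable ?\<mu>"
      using that by measurable
    have "0 \<le> C" using that(3)[of 0] by linarith
    then show "AE x' in ?\<mu>. norm (indicator {x<..y} x' * f x') \<le> norm (C * indicator {x<..y} x')"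
      using that(3) by (auto simp: indicator_def)
  qed
  have split: "{0<..b} = {0<..a} \<union> {a<..b}" using assms by auto
  have "I b = I a + (LINT s:{a<..b}|?\<mu>. X s)"
    unfolding I_def split
    by (rule set_integral_Un) (use assms ab int[OF _ Xm bdd] in auto)
  moreover have "(LINT x:{a<..b}|?\<mu>. X s) = X s * (G b - G a)"
    using me[OF ab] em[OF ab] by (simp add: set_lebesgue_integral_def)
  moreover have "(LINT x:{a<..b}|?\<mu>. X x) - (LINT x:{a<..b}|?\<mu>. X s) = (LINT x:{a<..b}|?\<mu>. X x - X s)"
    by (rule set_integral_diff(2)[symmetric]) (use int[OF ab Xm bdd] int[OF ab, of "\<lambda>_. X s" "\<bar>X s\<bar>"] in auto)
  moreover have "\<bar>LINT x:{a<..b}|?\<mu>. X x - X s\<bar> \<le> M * (b - a) * (G b - G a)"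
  proof -
    have dm: "(\<lambda>x. X x - X s) \<in> borel_measurable borel" using Xm by measurable
    have db: "\<bar>X x - X s\<bar> \<le> B + \<bar>X s\<bar>" for x using bdd[of x] by linarith
    have "\<bar>LINT x:{a<..b}|?\<mu>. X x - X s\<bar> \<le> (LINT x:{a<..b}|?\<mu>. \<bar>X x - X s\<bar>)"
      using set_integral_norm_bound[OF int[OF ab dm db]] by simp
    also have "\<dots> \<le> (LINT x:{a<..b}|?\<mu>. M * (b - a))"
    proof (rule set_integral_mono)
      show "set_integrable ?\<mu> {a<..b} (\<lambda>x. \<bar>X x - X s\<bar>)"
        using Xm db by (intro int[OF ab, where C="B + \<bar>X s\<bar>"]) auto
      show "set_integrable ?\<mu> {a<..b} (\<lambda>x. M * (b - a))"
        by (intro int[OF ab, where C="\<bar>M * (b - a)\<bar>"]) auto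
      fix x assume x: "x \<in> {a<..b}"
      have "\<bar>X x - X s\<bar> \<le> M * \<bar>x - s\<bar>"
        using lipschitz_onD[OF X, of x s] by (simp add: dist_real_def)
      also have "\<dots> \<le> M * (b - a)"
        using x assms lipschitz_on_nonneg[OF X] by (intro mult_left_mono) auto
      finally show "\<bar>X x - X s\<bar> \<le> M * (b - a)" .
    qed
    also have "\<dots> = M * (b - a) * (G b - G a)"
      using me[OF ab] em[OF ab] by (simp add: set_lebesgue_integral_def)
    finally show ?thesis .
  qed
  ultimately show ?thesis by simp
qed

lemma lipschitz_extend_clamp:
  fixes X :: "real \<Rightarrow> real"
  assumes "M-lipschitz_on {0..1} X"
  shows "M-lipschitz_on UNIV (\<lambda>x. X (max 0 (min 1 x)))"
proof (rule lipschitz_onI)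
  show "0 \<le> M" using assms by (rule lipschitz_on_nonneg)
  fix x y :: real
  have "dist (X (max 0 (min 1 x))) (X (max 0 (min 1 y))) \<le> M * dist (max 0 (min 1 x)) (max 0 (min 1 y))"
    by (rule lipschitz_onD[OF assms]) auto
  also have "\<dots> \<le> M * dist x y"
    using \<open>0 \<le> M\<close> by (intro mult_left_mono) (auto simp: dist_real_def)
  finally show "dist (X (max 0 (min 1 x))) (X (max 0 (min 1 y))) \<le> M * dist x y" .
qed

text \<open>
  The function \<open>F\<close> plays the role of the indefinite integral of \<open>X dY\<close>; its error bound is quadratic in the
  length of the interval, so that it disappears when Riemann sums are refined.  The differential
  \<open>dY\<close> is split as \<open>d(Y + N x) - d(N x)\<close>, a difference of two measures.
\<close>

lemma stieltjes_primitive_exists: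
  fixes X Y :: "real \<Rightarrow> real"
  assumes X: "M-lipschitz_on {0..1} X" and Y: "N-lipschitz_on {0..1} Y"
  obtains F where "\<And>a s b. \<lbrakk>0 \<le> a; a \<le> s; s \<le> b; b \<le> 1\<rbrakk> \<Longrightarrow>
      \<bar>F b - F a - X s * (Y b - Y a)\<bar> \<le> 3 * M * N * (b - a)\<^sup>2"
proof -
  define X' where "X' x = X (max 0 (min 1 x))" for x
  define Y' where "Y' x = Y (max 0 (min 1 x))" for x
  have X': "M-lipschitz_on UNIV X'" and Y': "N-lipschitz_on UNIV Y'"
    using lipschitz_extend_clamp[OF X] lipschitz_extend_clamp[OF Y] by (simp_all add: X'_def[abs_def] Y'_def[abs_def])
  have M: "M \<ge> 0" and N: "N \<ge> 0" using X Y by (auto dest: lipschitz_on_nonneg)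
  have bdd: "\<bar>X' x\<bar> \<le> \<bar>X 0\<bar> + M" for x
  proof -
    have "\<bar>X' x - X 0\<bar> \<le> M * \<bar>max 0 (min 1 x)\<bar>"
      using lipschitz_onD[OF X, of "max 0 (min 1 x)" 0] by (simp add: X'_def dist_real_def)
    also have "\<dots> \<le> M * 1" using M by (intro mult_left_mono) auto
    finally show ?thesis by linarith
  qed
  have Ylip: "\<bar>Y' x - Y' y\<bar> \<le> N * \<bar>x - y\<bar>" for x y
    using lipschitz_onD[OF Y', of x y] by (simp add: dist_real_def)
  define G1 where "G1 x = Y' x + N * x" for x
  define G2 where "G2 x = N * x" for x :: real
  have G1: "mono G1" "continuous_on UNIV G1"
  proof -
    show "mono G1"
    proof (rule monoI)
      fix x y :: real assume "x \<le> y"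
      then show "G1 x \<le> G1 y" using Ylip[of x y] by (simp add: G1_def algebra_simps abs_if split: if_splits)
    qed
    show "continuous_on UNIV G1" unfolding G1_def
      by (intro continuous_intros lipschitz_on_continuous_on[OF Y'])
  qed
  have G2: "mono G2" "continuous_on UNIV G2"
    using N by (auto simp: G2_def mono_def mult_left_mono intro!: continuous_intros)
  define F where "F x = (LINT s:{0<..x}|interval_measure G1. X' s) - (LINT s:{0<..x}|interval_measure G2. X' s)" for x
  show ?thesis
  proof (rule that[of F])
    fix a s b :: real assume *: "0 \<le> a" "a \<le> s" "s \<le> b" "b \<le> 1"
    have "\<bar>F b - F a - X' s * (Y' b - Y' a)\<bar> \<le> M * (b - a) * (G1 b - G1 a) + M * (b - a) * (G2 b - G2 a)"
      using interval_measure_integral_approx[OF X' bdd G1, of a s b]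
        interval_measure_integral_approx[OF X' bdd G2, of a s b] *
      unfolding F_def G1_def G2_def by (simp add: algebra_simps) 
    also have "\<dots> = M * (b - a) * (Y' b - Y' a + 2 * N * (b - a))"
      by (simp add: G1_def G2_def algebra_simps)
    also have "\<dots> \<le> M * (b - a) * (3 * N * (b - a))"
      using Ylip[of b a] * M by (intro mult_left_mono mult_nonneg_nonneg) (auto simp: algebra_simps)
    finally show "\<bar>F b - F a - X s * (Y b - Y a)\<bar> \<le> 3 * M * N * (b - a)\<^sup>2"
      using * by (simp add: X'_def Y'_def power2_eq_square algebra_simps)
  qed
qed

definition riemann_sum :: "(real \<Rightarrow> real) \<Rightarrow> (real \<Rightarrow> real) \<Rightarrow> nat \<Rightarrow> real" where
  "riemann_sum X Y n = (\<Sum>i<n. X (i / n) * (Y (Suc i / n) - Y (i / n)))"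

definition line_integral :: "(real \<Rightarrow> real) \<Rightarrow> (real \<Rightarrow> real) \<Rightarrow> real" where
  "line_integral X Y = lim (riemann_sum X Y)"

lemma sum_grid_telescope:
  fixes F :: "real \<Rightarrow> 'a::ab_group_add"
  assumes "n > 0"
  shows "(\<Sum>i<n. F (Suc i / n) - F (i / n)) = F 1 - F 0"
  using sum_lessThan_telescope[of "\<lambda>i. F (i / n)" n] assms by simp

lemma riemann_sum_primitive:
  fixes F :: "real \<Rightarrow> real"
  assumes F: "\<And>a b. \<lbrakk>0 \<le> a; a \<le> b; b \<le> 1\<rbrakk> \<Longrightarrow> \<bar>F b - F a - X a * (Y b - Y a)\<bar> \<le> C * (b - a)\<^sup>2"
    and n: "n > 0"
  shows "\<bar>riemann_sum X Y n - (F 1 - F 0)\<bar> \<le> C / n"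
proof -
  have "\<bar>riemann_sum X Y n - (F 1 - F 0)\<bar>
      = \<bar>\<Sum>i<n. X (i / n) * (Y (Suc i / n) - Y (i / n)) - (F (Suc i / n) - F (i / n))\<bar>"
    unfolding sum_grid_telescope[OF n, symmetric] riemann_sum_def by (simp add: sum_subtractf)
  also have "\<dots> \<le> (\<Sum>i<n. C * (1 / n)\<^sup>2)"
  proof (intro order.trans[OF sum_abs] sum_mono)
    fix i assume i: "i \<in> {..<n}"
    have "\<bar>F (Suc i / n) - F (i / n) - X (i / n) * (Y (Suc i / n) - Y (i / n))\<bar> \<le> C * (Suc i / n - i / n)\<^sup>2"
      using i by (intro F) (auto simp: field_simps)
    also have "Suc i / n - i / n = 1 / real n" using n by (simp add: field_simps)
    finally show "\<bar>X (i / n) * (Y (Suc i / n) - Y (i / n)) - (F (Suc i / n) - F (i / n))\<bar> \<le> C * (1 / n)\<^sup>2"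
      by (simp add: abs_minus_commute)
  qed
  also have "\<dots> = C / n" using n by (simp add: power2_eq_square)
  finally show ?thesis .
qed

lemma line_integral_primitive:
  fixes F :: "real \<Rightarrow> real"
  assumes F: "\<And>a b. \<lbrakk>0 \<le> a; a \<le> b; b \<le> 1\<rbrakk> \<Longrightarrow> \<bar>F b - F a - X a * (Y b - Y a)\<bar> \<le> C * (b - a)\<^sup>2"
  shows "line_integral X Y = F 1 - F 0"
proof -
  have "(\<lambda>n. riemann_sum X Y n - (F 1 - F 0)) \<longlonglongrightarrow> 0"
  proof (rule tendsto_rabs_zero_cancel, rule real_tendsto_sandwich[where f="\<lambda>_. 0"])
    show "\<forall>\<^sub>F n in sequentially. \<bar>riemann_sum X Y n - (F 1 - F 0)\<bar> \<le> C / n"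
      using eventually_gt_at_top[of 0] by eventually_elim (rule riemann_sum_primitive[OF F])
    show "(\<lambda>n. C / real n) \<longlonglongrightarrow> 0"
      by (rule lim_const_over_n)
  qed auto
  then show ?thesis
    unfolding line_integral_def by (intro limI) (simp add: LIM_zero_iff)
qed

text \<open>
  The rate is uniform in the integrand and the integrator once their Lipschitz constants are bounded,
  which allows limits of Riemann sums to be interchanged with the evolution in time.
\<close>

lemma riemann_sum_error:
  assumes "M-lipschitz_on {0..1} X" "N-lipschitz_on {0..1} Y" "n > 0"
  shows "\<bar>riemann_sum X Y n - line_integral X Y\<bar> \<le> 3 * M * N / n"
proof -
  obtain F where F: "\<And>a s b. \<lbrakk>0 \<le> a; a \<le> s; s \<le> b; b \<le> 1\<rbrakk> \<Longrightarrow>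
      \<bar>F b - F a - X s * (Y b - Y a)\<bar> \<le> 3 * M * N * (b - a)\<^sup>2"
    using stieltjes_primitive_exists[OF assms(1,2)] by blast
  show ?thesis
    using riemann_sum_primitive[of F X Y "3*M*N" n] line_integral_primitive[of F X Y "3*M*N"] F assms(3) by simp
qed

lemma riemann_sum_tendsto:
  assumes "M-lipschitz_on {0..1} X" "N-lipschitz_on {0..1} Y"
  shows "riemann_sum X Y \<longlonglongrightarrow> line_integral X Y"
proof (rule LIM_zero_cancel, rule tendsto_rabs_zero_cancel, rule real_tendsto_sandwich[where f="\<lambda>_. 0"])
  show "\<forall>\<^sub>F n in sequentially. \<bar>riemann_sum X Y n - line_integral X Y\<bar> \<le> 3 * M * N / n"
    using eventually_gt_at_top[of 0] by eventually_elim (rule riemann_sum_error[OF assms])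
  show "(\<lambda>n. 3 * M * N / real n) \<longlonglongrightarrow> 0"
    by (rule lim_const_over_n)
qed auto

text \<open>
  For the primitive \<open>F\<close> of \<open>X dY\<close>, a tagged division contributes an error of at most a constant times the
  sum of \<open>(r b - r a)\<^sup>2\<close> over its intervals.  The increments of \<open>r\<close> are nonnegative and add up
  to 1, so uniform continuity of \<open>r\<close> makes this sum small.
\<close>

lemma signed_area_reparametrized:
  fixes \<sigma> \<gamma> :: "real \<Rightarrow> real \<times> real"
  assumes \<gamma>: "\<And>s. s \<in> {0..1} \<Longrightarrow> \<gamma> s = \<sigma> (r s)"
    and X: "M-lipschitz_on {0..1} (fst \<circ> \<sigma>)" and Y: "N-lipschitz_on {0..1} (snd \<circ> \<sigma>)"
    and r: "continuous_on {0..1} r" "mono_on {0..1} r" "r 0 = 0" "r 1 = 1"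
  shows "signed_area \<gamma> = line_integral (fst \<circ> \<sigma>) (snd \<circ> \<sigma>)"
proof -
  obtain F where F: "\<And>a s b. \<lbrakk>0 \<le> a; a \<le> s; s \<le> b; b \<le> 1\<rbrakk> \<Longrightarrow>
      \<bar>F b - F a - fst (\<sigma> s) * (snd (\<sigma> b) - snd (\<sigma> a))\<bar> \<le> 3 * M * N * (b - a)\<^sup>2"
    using stieltjes_primitive_exists[OF X Y] unfolding o_def by metis
  have MN: "0 \<le> 3 * M * N" using lipschitz_on_nonneg[OF X] lipschitz_on_nonneg[OF Y] by simp
  have r01: "r s \<in> {0..1}" if "s \<in> {0..1}" for s
    using that r mono_onD[OF r(2), of 0 s] mono_onD[OF r(2), of s 1] by auto
  have I: "line_integral (fst \<circ> \<sigma>) (snd \<circ> \<sigma>) = F (r 1) - F (r 0)"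
    using line_integral_primitive[of F "fst \<circ> \<sigma>" "snd \<circ> \<sigma>" "3*M*N"] F r by simp
  let ?S = "\<lambda>D. \<Sum>(s, K)\<in>D. fst (\<gamma> s) * (snd (\<gamma> (Sup K)) - snd (\<gamma> (Inf K)))"
  let ?F = "division_filter {0..1::real}"
  have "(?S \<longlongrightarrow> F (r 1) - F (r 0)) ?F"
  proof (rule tendstoI)
    fix e :: real assume e: "e > 0"
    \<comment> \<open>Bounding the increments of \<open>r\<close> by \<open>\<eta>\<close> bounds the total error by \<open>3 M N \<eta> < e\<close>.\<close>
    define \<eta> where "\<eta> = e / (3 * M * N + 1)"
    have \<eta>: "\<eta> > 0" using MN e by (simp add: \<eta>_def)
    have "3 * M * N * \<eta> < (3 * M * N + 1) * \<eta>" using \<eta> by (simp add: algebra_simps)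
    also have "\<dots> = e" using MN by (simp add: \<eta>_def)
    finally have \<eta>_small: "3 * M * N * \<eta> < e" .
    have "uniformly_continuous_on {0..1} r"
      using r(1) by (intro compact_uniformly_continuous) auto
    then obtain \<delta> where \<delta>: "\<delta> > 0"
      "\<And>x y. \<lbrakk>x \<in> {0..1}; y \<in> {0..1}; \<bar>y - x\<bar> < \<delta>\<rbrakk> \<Longrightarrow> \<bar>r y - r x\<bar> < \<eta>"
      using \<eta> unfolding uniformly_continuous_on_def dist_real_def by metis
    have "dist (?S D) (F (r 1) - F (r 0)) < e"
      if D: "D tagged_division_of {0..1}" and fine: "(\<lambda>s. ball s (\<delta> / 2)) fine D" for D
    proof -
      have fin: "finite D" using D by auto
      have tel: "(\<Sum>(s, K)\<in>D. F (r (Sup K)) - F (r (Inf K))) = F (r 1) - F (r 0)"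
        "(\<Sum>(s, K)\<in>D. r (Sup K) - r (Inf K)) = r 1 - r 0"
        using additive_tagged_division_1[OF _ D, of "F \<circ> r"] additive_tagged_division_1[OF _ D, of r] by auto
      have "\<bar>fst (\<gamma> s) * (snd (\<gamma> (Sup K)) - snd (\<gamma> (Inf K))) - (F (r (Sup K)) - F (r (Inf K)))\<bar>
          \<le> 3 * M * N * \<eta> * (r (Sup K) - r (Inf K))" if sK: "(s, K) \<in> D" for s K
      proof -
        obtain a b where "K = cbox a b" using tagged_division_ofD(4)[OF D sK] by blast
        moreover have s: "s \<in> K" using tagged_division_ofD(2)[OF D sK] .
        ultimately have K: "K = {a..b}" "a \<le> s" "s \<le> b" by auto
        have sub: "K \<subseteq> {0..1}" using tagged_division_ofD(3)[OF D sK] .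
        have "K \<subseteq> ball s (\<delta> / 2)" using fine sK by (auto simp: fine_def)
        moreover have "a \<in> K" "b \<in> K" using K by auto
        ultimately have "dist s a < \<delta> / 2" "dist s b < \<delta> / 2" by auto
        then have "\<bar>b - a\<bar> < \<delta>" unfolding dist_real_def by linarith
        moreover have ab: "a \<in> {0..1}" "b \<in> {0..1}" "s \<in> {0..1}" using sub K by auto
        ultimately have osc: "\<bar>r b - r a\<bar> < \<eta>" using \<delta>(2) by blast
        have rm: "r a \<le> r s" "r s \<le> r b" using ab K by (auto intro: mono_onD[OF r(2)])
        have "\<bar>F (r b) - F (r a) - fst (\<sigma> (r s)) * (snd (\<sigma> (r b)) - snd (\<sigma> (r a)))\<bar> \<le> 3 * M * N * (r b - r a)\<^sup>2"
          using rm r01 ab by (intro F) auto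
        also have "\<dots> \<le> 3 * M * N * (\<eta> * (r b - r a))"
          unfolding power2_eq_square using osc rm MN by (intro mult_left_mono mult_right_mono) auto
        finally show ?thesis using K ab \<gamma> by (simp add: algebra_simps abs_minus_commute)
      qed
      then have "\<bar>?S D - (F (r 1) - F (r 0))\<bar> \<le> (\<Sum>(s, K)\<in>D. 3 * M * N * \<eta> * (r (Sup K) - r (Inf K)))"
        unfolding tel(1)[symmetric] sum_subtractf[symmetric]
        by (intro order.trans[OF sum_abs] sum_mono) (auto simp: split_def)
      also have "\<dots> = 3 * M * N * \<eta>"
        using tel(2) r by (simp add: sum_distrib_left[symmetric] split_def)
      finally show ?thesis using \<eta>_small by (simp add: dist_real_def)
    qed
    then show "\<forall>\<^sub>F D in ?F. dist (?S D) (F (r 1) - F (r 0)) < e"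
      unfolding eventually_division_filter
      by (intro exI[of _ "\<lambda>s. ball s (\<delta> / 2)"]) (auto simp: gauge_def \<delta>)
  qed
  moreover have "?F \<noteq> bot" using division_filter_not_empty[of 0 "1::real"] by simp
  ultimately show ?thesis
    unfolding signed_area_def I by (rule tendsto_Lim[rotated])
qed

section \<open>Signed area as an integral of winding numbers\<close>

text \<open>
  This identifies area in the complex plane with area in \<open>real^2\<close>, so that the formula for the area of a
  triangle carries over.
\<close>

lemma lborel_complex_eq_distr: "lborel = distr (lborel :: (real^2) measure) borel (\<lambda>v. Complex (v $ 1) (v $ 2))"
proof (rule lborel_eqI)
  let ?f = "\<lambda>v::real^2. Complex (v $ 1) (v $ 2)"
  have univ: "(UNIV :: 2 set) = {1, 2}" using exhaust_2 by auto
  have meas: "?f \<in> borel_measurable borel"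
    by (intro borel_measurable_continuous_onI) (auto simp: Complex_eq intro!: continuous_intros)
  show "emeasure (distr lborel borel ?f) (box l u) = (\<Prod>b\<in>Basis. (u - l) \<bullet> b)"
    if lu: "\<And>b. b \<in> Basis \<Longrightarrow> l \<bullet> b \<le> u \<bullet> b" for l u :: complex
  proof -
    let ?l = "vector [Re l, Im l] :: real^2" and ?u = "vector [Re u, Im u] :: real^2"
    have "?f -` box l u = box ?l ?u"
      by (auto simp: mem_box_cart forall_2 in_box_complex_iff)
    then have "emeasure (distr lborel borel ?f) (box l u) = emeasure lborel (box ?l ?u)"
      using meas by (simp add: emeasure_distr)
    also have "\<dots> = (\<Prod>b\<in>Basis. (?u - ?l) \<bullet> b)"
    proof (rule emeasure_lborel_box)
      have "Re l \<le> Re u" "Im l \<le> Im u" using lu[of 1] lu[of \<i>] by (auto simp: Basis_complex_def)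
      then have "\<forall>i. ?l $ i \<le> ?u $ i" by (simp add: forall_2)
      then show "?l \<bullet> b \<le> ?u \<bullet> b" if "b \<in> Basis" for b
        using that by (auto simp: Basis_vec_def inner_axis)
    qed
    also have "(\<Prod>b\<in>Basis. (?u - ?l) \<bullet> b) = (Re u - Re l) * (Im u - Im l)"
    proof -
      have "axis 1 1 \<noteq> (axis 2 1 :: real^2)" by (simp add: axis_eq_axis)
      then show ?thesis by (simp add: Basis_vec_def univ inner_axis)
    qed
    also have "\<dots> = (\<Prod>b\<in>Basis. (u - l) \<bullet> b)" by (simp add: Basis_complex_def)
    finally show ?thesis .
  qed
qed simp

text \<open>
  Twice the signed area of the triangle, positive if \<open>a\<close>, \<open>b\<close>, \<open>c\<close> are in counter-clockwise order.
\<close>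

definition signed_area2 :: "complex \<Rightarrow> complex \<Rightarrow> complex \<Rightarrow> real" where
  "signed_area2 a b c = Im ((b - a) * cnj (b - c))"

lemma measure_complex_triangle:
  "measure lborel (convex hull {a, b, c :: complex}) = \<bar>signed_area2 a b c\<bar> / 2"
proof -
  let ?f = "\<lambda>v::real^2. Complex (v $ 1) (v $ 2)"
  let ?g = "\<lambda>z. vector [Re z, Im z] :: real^2"
  have fg: "?f (?g z) = z" for z by simp
  have lin: "linear ?f" by (rule linearI) (auto simp: complex_eq_iff)
  have inj: "inj ?f" by (auto simp: inj_on_def vec_eq_iff forall_2)
  have meas: "?f \<in> borel_measurable borel"
    by (intro borel_measurable_continuous_onI) (auto simp: Complex_eq intro!: continuous_intros)
  have cl: "closed (convex hull {a, b, c})"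
    by (intro compact_imp_closed finite_imp_compact_convex_hull) auto
  have "convex hull {a, b, c} = ?f ` (convex hull {?g a, ?g b, ?g c})"
    using convex_hull_linear_image[OF lin, of "{?g a, ?g b, ?g c}"] by simp
  then have "?f -` (convex hull {a, b, c}) = convex hull {?g a, ?g b, ?g c}"
    using inj by (simp add: inj_vimage_image_eq)
  then have "measure lborel (convex hull {a, b, c}) = measure lborel (convex hull {?g a, ?g b, ?g c})"
    using meas cl by (subst lborel_complex_eq_distr, subst measure_distr) (auto simp: borel_closed)
  also have "\<dots> = \<bar>signed_area2 a b c\<bar> / 2"
    unfolding content_triangle by (simp add: signed_area2_def algebra_simps)
  finally show ?thesis .
qed

lemma winding_number_triangle_boundary:
  assumes "z \<notin> closed_segment a b" "z \<notin> closed_segment b c" "z \<notin> closed_segment c a"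
  shows "winding_number (linepath a b) z + winding_number (linepath b c) z + winding_number (linepath c a) z
       = of_real (sgn (signed_area2 a b c) * indicator (convex hull {a, b, c}) z)"
proof -
  let ?p = "linepath a b +++ linepath b c +++ linepath c a"
  have "winding_number (linepath a b) z + winding_number (linepath b c) z + winding_number (linepath c a) z
      = winding_number ?p z"
    using assms by (simp add: winding_number_join path_image_join)
  also have "\<dots> = of_real (sgn (signed_area2 a b c) * indicator (convex hull {a, b, c}) z)"
  proof (cases "z \<in> convex hull {a, b, c}")
    case False
    have "winding_number ?p z = 0"
    proof (rule winding_number_zero_outside[where s="convex hull {a, b, c}"])
      have "closed_segment a b \<subseteq> convex hull {a, b, c}" "closed_segment b c \<subseteq> convex hull {a, b, c}"
        "closed_segment c a \<subseteq> convex hull {a, b, c}"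
        by (auto simp: segment_convex_hull intro: hull_mono[THEN subsetD, rotated])
      then show "path_image ?p \<subseteq> convex hull {a, b, c}" by (auto simp: path_image_join)
    qed (use False in auto)
    then show ?thesis using False by simp
  next
    case True
    have "z \<notin> frontier (convex hull {a, b, c})"
      using assms by (subst frontier_of_triangle) auto
    then have int: "z \<in> interior (convex hull {a, b, c})"
      using True closure_subset[of "convex hull {a, b, c}"] by (auto simp: frontier_def)
    obtain \<alpha> \<beta> \<gamma> where abc: "\<alpha> \<ge> 0" "\<beta> \<ge> 0" "\<gamma> \<ge> 0" "\<alpha> + \<beta> + \<gamma> = 1"
      and z: "z = \<alpha> *\<^sub>R a + \<beta> *\<^sub>R b + \<gamma> *\<^sub>R c"
      using True unfolding convex_hull_3 by auto
    have "\<gamma> \<noteq> 0"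
    proof
      assume "\<gamma> = 0"
      then have "z \<in> closed_segment a b"
        using abc z unfolding closed_segment_def by (auto intro!: exI[of _ \<beta>])
      then show False using assms by simp
    qed
    then have g: "\<gamma> > 0" using abc by simp
    have \<alpha>: "\<alpha> = 1 - \<beta> - \<gamma>" using abc by simp
    \<comment> \<open>The sign attached to an interior point \<open>z\<close> is the orientation of the whole triangle.\<close>
    have eq: "Im ((b - a) * cnj (b - z)) = \<gamma> * signed_area2 a b c"
      unfolding z signed_area2_def \<alpha> by (simp add: algebra_simps)
    have nz: "signed_area2 a b c \<noteq> 0"
    proof
      assume "signed_area2 a b c = 0"
      then have "measure lborel (convex hull {a, b, c}) = 0" by (simp add: measure_complex_triangle)
      moreover have "convex hull {a, b, c} \<in> lmeasurable"
        by (intro lmeasurable_compact finite_imp_compact_convex_hull) auto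
      moreover have "measure lebesgue (convex hull {a, b, c}) = measure lborel (convex hull {a, b, c})"
        by (intro measure_completion) (auto intro!: borel_closed compact_imp_closed finite_imp_compact_convex_hull)
      ultimately have "negligible (convex hull {a, b, c})" by (simp add: negligible_iff_measure)
      then show False
        using int interior_subset open_interior negligible_subset open_not_negligible by blast
    qed
    show ?thesis
      unfolding winding_number_triangle[OF int] eq using True nz g
      by (auto simp: zero_less_mult_iff sgn_if)
  qed
  finally show ?thesis .
qed

lemma sum_lessThan_double: "(\<Sum>i<2 * m. f i) = (\<Sum>i<m. f (2 * i) + f (Suc (2 * i)))"
  for f :: "nat \<Rightarrow> 'a::comm_monoid_add"
  by (induction m) (auto simp: add.assoc)

lemma winding_number_subpath_grid:
  assumes \<sigma>: "path \<sigma>" "w \<notin> path_image \<sigma>" and n: "n > 0"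
  shows "(\<Sum>i<n. winding_number (subpath (i / n) (Suc i / n) \<sigma>) w) = winding_number \<sigma> w"
proof -
  have "(\<Sum>i<j. winding_number (subpath (i / n) (Suc i / n) \<sigma>) w) = winding_number (subpath 0 (j / n) \<sigma>) w"
    if "j \<le> n" for j
    using that
  proof (induction j)
    case 0
    have "w \<noteq> \<sigma> 0" using \<sigma>(2) by (auto simp: path_image_def)
    then show ?case by simp
  next
    case (Suc j)
    then show ?case
      using n winding_number_subpath_combine[OF \<sigma>, of 0 "j / n" "Suc j / n"]
      by (simp add: field_simps)
  qed
  from this[of n] show ?thesis using n by simp
qed

text \<open>
  Once the mesh is small compared with the distance from \<open>w\<close> to the curve, each arc and its chord stay in a
  ball that does not contain \<open>w\<close>, so they contribute the same to the winding number.
\<close>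

lemma winding_number_inscribed_polygon:
  fixes \<sigma> :: "real \<Rightarrow> complex"
  assumes lip: "M-lipschitz_on {0..1} \<sigma>" and w: "w \<notin> path_image \<sigma>"
  shows "\<forall>\<^sub>F n in sequentially.
    (\<Sum>i<n. winding_number (linepath (\<sigma> (i / n)) (\<sigma> (Suc i / n))) w) = winding_number \<sigma> w"
proof -
  have M: "M \<ge> 0" using lip by (rule lipschitz_on_nonneg)
  have path: "path \<sigma>" unfolding path_def by (rule lipschitz_on_continuous_on[OF lip])
  have "closed (path_image \<sigma>)" using path by (simp add: closed_path_image)
  then obtain \<delta> where \<delta>: "\<delta> > 0" "ball w \<delta> \<subseteq> - path_image \<sigma>"
    using w by (meson Compl_iff open_Compl openE)
  have far: "\<delta> \<le> norm (\<sigma> t - w)" if "t \<in> {0..1}" for t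
    using \<delta> that by (auto simp: path_image_def dist_norm norm_minus_commute subset_iff not_less[symmetric])
  have "(\<lambda>n. (2 * M) / real n) \<longlonglongrightarrow> 0" by (rule lim_const_over_n)
  then have "\<forall>\<^sub>F n in sequentially. (2 * M) / real n < \<delta>" by (rule order_tendstoD(2)[OF _ \<delta>(1)])
  moreover have "\<forall>\<^sub>F n in sequentially. n > (0::nat)" by (rule eventually_gt_at_top)
  ultimately show ?thesis
  proof eventually_elim
    case (elim n)
    have "winding_number (linepath (\<sigma> (i / n)) (\<sigma> (Suc i / n))) w = winding_number (subpath (i / n) (Suc i / n) \<sigma>) w"
      if i: "i < n" for i
    proof (rule winding_number_nearby_paths_eq)
      have ends: "i / n \<in> {0..1}" "Suc i / n \<in> {0..1}" using i by auto
      show "path (subpath (i / n) (Suc i / n) \<sigma>)" using path ends by simp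
      fix t :: real assume t: "t \<in> {0..1}"
      let ?a = "\<sigma> (i / n)" and ?s = "(Suc i / n - i / n) * t + i / n"
      have s: "?s = (i + t) / n" using elim by (simp add: field_simps)
      have s01: "?s \<in> {0..1}" using t i elim unfolding s by (auto simp: field_simps)
      have in_ball: "norm (\<sigma> u - ?a) \<le> M / n" if "i / n \<le> u" "u \<le> Suc i / n" "u \<in> {0..1}" for u
      proof -
        have "norm (\<sigma> u - ?a) \<le> M * \<bar>u - i / n\<bar>"
          using lipschitz_onD[OF lip that(3) ends(1)] by (simp add: dist_norm)
        also have "\<bar>u - i / n\<bar> \<le> 1 / n"
          using that by (simp add: add_divide_distrib)
        then have "M * \<bar>u - i / n\<bar> \<le> M * (1 / n)" using M by (rule mult_left_mono)
        finally show ?thesis by simp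
      qed
      have 1: "norm (subpath (i / n) (Suc i / n) \<sigma> t - ?a) \<le> M / n"
        unfolding subpath_def using t i elim s01
        by (intro in_ball) (auto simp: s field_simps)
      have "linepath ?a (\<sigma> (Suc i / n)) t - ?a = t *\<^sub>R (\<sigma> (Suc i / n) - ?a)"
        by (simp add: linepath_def algebra_simps)
      then have "norm (linepath ?a (\<sigma> (Suc i / n)) t - ?a) \<le> 1 * norm (\<sigma> (Suc i / n) - ?a)"
        using t by (simp add: mult_left_le_one_le)
      also have "\<dots> \<le> M / n" using in_ball[of "Suc i / n"] ends by (simp add: divide_right_mono)
      finally have "norm (linepath ?a (\<sigma> (Suc i / n)) t - subpath (i / n) (Suc i / n) \<sigma> t) \<le> M / n + M / n"
        using 1 by (smt (verit) norm_triangle_ineq4 add_diff_cancel diff_add_cancel diff_diff_eq2)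
      also have "\<dots> < \<delta>" using elim by simp
      also have "\<delta> \<le> norm (subpath (i / n) (Suc i / n) \<sigma> t - w)"
        unfolding subpath_def by (rule far[OF s01])
      finally show "norm (linepath ?a (\<sigma> (Suc i / n)) t - subpath (i / n) (Suc i / n) \<sigma> t)
          < norm (subpath (i / n) (Suc i / n) \<sigma> t - w)" .
    qed (auto simp: pathstart_subpath pathfinish_subpath)
    then show ?case
      using winding_number_subpath_grid[OF path w, of n] elim by simp
  qed
qed


text \<open>
  The \<open>2^(k+1)\<close>-gon inscribed in \<open>\<sigma>\<close> arises from the \<open>2^k\<close>-gon by attaching a triangle to each edge.
  The corner correction is the change in winding number that these triangles cause, expressed through
  indicator functions so that it is visibly integrable.
\<close>

definition corner_correction :: "(real \<Rightarrow> complex) \<Rightarrow> nat \<Rightarrow> complex \<Rightarrow> real" where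
  "corner_correction \<sigma> k w = (\<Sum>i<2^k.
     let a = \<sigma> (i / 2^k); m = \<sigma> (Suc (2 * i) / 2^Suc k); b = \<sigma> (Suc i / 2^k)
     in sgn (signed_area2 a m b) * indicator (convex hull {a, m, b}) w)"

text \<open>
  For a closed curve, the signed area of the inscribed \<open>n\<close>-gon.
\<close>

definition trapezoid_sum :: "(real \<Rightarrow> complex) \<Rightarrow> nat \<Rightarrow> real" where
  "trapezoid_sum \<sigma> n = (\<Sum>i<n. (Re (\<sigma> (i / n)) + Re (\<sigma> (Suc i / n))) / 2 * (Im (\<sigma> (Suc i / n)) - Im (\<sigma> (i / n))))"

lemma integrable_triangle:
  "integrable lborel (\<lambda>w. c * indicator (convex hull {a, m, b :: complex}) w :: real)"
  by (intro integrable_mult_right integrable_real_indicator emeasure_bounded_finite finite_imp_bounded_convex_hull)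
     (auto intro!: borel_closed compact_imp_closed finite_imp_compact_convex_hull)

lemma integral_triangle:
  "(\<integral>w. c * indicator (convex hull {a, m, b :: complex}) w \<partial>lborel) = c * (\<bar>signed_area2 a m b\<bar> / 2)"
  using measure_complex_triangle[of a m b] by simp

lemma signed_area2_trapezoids:
  "signed_area2 a m b / 2 = (Re a + Re m) / 2 * (Im m - Im a) + (Re m + Re b) / 2 * (Im b - Im m)
     - (Re a + Re b) / 2 * (Im b - Im a)"
proof -
  have "signed_area2 a m b = (Re a + Re m) * (Im m - Im a) + (Re m + Re b) * (Im b - Im m) - (Re a + Re b) * (Im b - Im a)"
    by (simp add: signed_area2_def algebra_simps)
  then show ?thesis by (simp only: diff_divide_distrib add_divide_distrib[of "_ * _"] times_divide_eq_left)
qed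

lemma integral_corner_correction:
  "integrable lborel (corner_correction \<sigma> k)"
  "(\<integral>w. corner_correction \<sigma> k w \<partial>lborel) = trapezoid_sum \<sigma> (2^Suc k) - trapezoid_sum \<sigma> (2^k)"
proof -
  show "integrable lborel (corner_correction \<sigma> k)"
    unfolding corner_correction_def[abs_def] Let_def
    by (intro Bochner_Integration.integrable_sum integrable_triangle)
  have "(\<integral>w. corner_correction \<sigma> k w \<partial>lborel) = (\<Sum>i<2^k.
      signed_area2 (\<sigma> (i / 2^k)) (\<sigma> (Suc (2 * i) / 2^Suc k)) (\<sigma> (Suc i / 2^k)) / 2)"
    unfolding corner_correction_def Let_def
    by (subst Bochner_Integration.integral_sum[OF integrable_triangle], unfold integral_triangle)
       (rule sum.cong, simp_all add: sgn_if)
  also have "\<dots> = trapezoid_sum \<sigma> (2^Suc k) - trapezoid_sum \<sigma> (2^k)"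
  proof -
    have grid: "real (2 * i) / real (2 * 2^k) = real i / 2^k"
      "real (Suc (2 * i)) / real (2 * 2^k) = real (Suc (2 * i)) / 2^Suc k"
      "real (Suc (Suc (2 * i))) / real (2 * 2^k) = real (Suc i) / 2^k"
      "real i / real (2^k) = real i / 2^k" for i :: nat
      by (simp_all add: field_simps)
    show ?thesis
      unfolding trapezoid_sum_def power_Suc[of "2::nat"] sum_lessThan_double grid
      unfolding sum_subtractf[symmetric] signed_area2_trapezoids ..
  qed
  finally show "(\<integral>w. corner_correction \<sigma> k w \<partial>lborel) = trapezoid_sum \<sigma> (2^Suc k) - trapezoid_sum \<sigma> (2^k)" .
qed

text \<open>
  There are \<open>2^k\<close> triangles, each of diameter \<open>O(2^-k)\<close> and hence of area \<open>O(4^-k)\<close>.  The corrections are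
  therefore summable in \<open>L\<^sup>1\<close>, although the winding numbers of the polygons need not be bounded uniformly.
\<close>

lemma integral_abs_corner_correction:
  assumes lip: "M-lipschitz_on {0..1} \<sigma>"
  shows "(\<integral>w. \<bar>corner_correction \<sigma> k w\<bar> \<partial>lborel) \<le> M\<^sup>2 * (1 / 2)^k"
proof -
  have M: "M \<ge> 0" using lip by (rule lipschitz_on_nonneg)
  define T where "T i w = sgn (signed_area2 (\<sigma> (i / 2^k)) (\<sigma> (Suc (2 * i) / 2^Suc k)) (\<sigma> (Suc i / 2^k))) *
     indicator (convex hull {\<sigma> (i / 2^k), \<sigma> (Suc (2 * i) / 2^Suc k), \<sigma> (Suc i / 2^k)}) w" for i :: nat and w :: complex
  have T: "integrable lborel (T i)" for i
    unfolding T_def by (rule integrable_triangle)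
  have c: "corner_correction \<sigma> k w = (\<Sum>i<2^k. T i w)" for w
    by (simp only: corner_correction_def T_def Let_def)
  have "(\<integral>w. \<bar>corner_correction \<sigma> k w\<bar> \<partial>lborel) \<le> (\<integral>w. (\<Sum>i<2^k. \<bar>T i w\<bar>) \<partial>lborel)"
    by (intro integral_mono integrable_abs integral_corner_correction Bochner_Integration.integrable_sum T)
       (simp only: c sum_abs)
  also have "\<dots> = (\<Sum>i<2^k. \<integral>w. \<bar>T i w\<bar> \<partial>lborel)"
    by (intro Bochner_Integration.integral_sum integrable_abs T)
  also have "\<dots> \<le> (\<Sum>i<(2::nat)^k. (M * (1 / 2^k)) * (M * (1 / 2^k)))"
  proof (rule sum_mono)
    fix i :: nat assume i: "i \<in> {..<2^k}"
    have "real i + 1 \<le> 2 ^ k" using i by (metis Suc_leI lessThan_iff of_nat_Suc of_nat_le_iff of_nat_numeral of_nat_power add.commute)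
    moreover from this have "real i \<le> 2 ^ k" by linarith
    ultimately have "real i / 2^k \<le> 1" "real (Suc i) / 2^k \<le> 1" "real (Suc (2 * i)) / 2^Suc k \<le> 1"
      by (simp_all add: divide_le_eq)
    then have g: "i / 2^k \<in> {0..1::real}" "Suc (2 * i) / 2^Suc k \<in> {0..1::real}" "Suc i / 2^k \<in> {0..1::real}"
      by simp_all
    let ?a = "\<sigma> (i / 2^k)" and ?m = "\<sigma> (Suc (2 * i) / 2^Suc k)" and ?b = "\<sigma> (Suc i / 2^k)"
    have am: "norm (?m - ?a) \<le> M * (1 / 2^k)"
    proof -
      have "norm (?m - ?a) \<le> M * \<bar>Suc (2 * i) / 2^Suc k - i / 2^k\<bar>"
        using lipschitz_onD[OF lip g(2,1)] by (simp add: dist_norm)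
      also have "\<dots> \<le> M * (1 / 2^k)" using M by (intro mult_left_mono) (auto simp: field_simps)
      finally show ?thesis .
    qed
    have mb: "norm (?m - ?b) \<le> M * (1 / 2^k)"
    proof -
      have "norm (?m - ?b) \<le> M * \<bar>Suc (2 * i) / 2^Suc k - Suc i / 2^k\<bar>"
        using lipschitz_onD[OF lip g(2,3)] by (simp add: dist_norm)
      also have "\<dots> \<le> M * (1 / 2^k)" using M by (intro mult_left_mono) (auto simp: field_simps)
      finally show ?thesis .
    qed
    have "(\<integral>w. \<bar>T i w\<bar> \<partial>lborel) = (\<integral>w. \<bar>sgn (signed_area2 ?a ?m ?b)\<bar> * indicator (convex hull {?a, ?m, ?b}) w \<partial>lborel)"
      unfolding T_def by (simp add: abs_mult)
    also have "\<dots> = \<bar>sgn (signed_area2 ?a ?m ?b)\<bar> * (\<bar>signed_area2 ?a ?m ?b\<bar> / 2)"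
      by (rule integral_triangle)
    also have "\<dots> \<le> \<bar>signed_area2 ?a ?m ?b\<bar>" by (simp add: sgn_if)
    also have "\<dots> \<le> norm (?m - ?a) * norm (?m - ?b)"
      unfolding signed_area2_def by (metis abs_Im_le_cmod complex_mod_cnj norm_mult)
    also have "\<dots> \<le> (M * (1 / 2^k)) * (M * (1 / 2^k))"
      using am mb M by (intro mult_mono) auto
    finally show "(\<integral>w. \<bar>T i w\<bar> \<partial>lborel) \<le> (M * (1 / 2^k)) * (M * (1 / 2^k))" .
  qed
  also have "\<dots> = 2^k * ((M * (1 / 2^k)) * (M * (1 / 2^k)))"
    unfolding sum_constant card_lessThan of_nat_power of_nat_numeral ..
  also have "\<dots> = M\<^sup>2 * (1 / 2)^k"
  proof -
    have "q * ((M * (1 / q)) * (M * (1 / q))) = M\<^sup>2 * (1 / q)" if "q > 0" for q :: real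
      using that by (simp add: power2_eq_square)
    from this[of "2^k"] show ?thesis by (simp only: power_one_over zero_less_power zero_less_numeral)
  qed
  finally show ?thesis .
qed

lemma abs_half_mult_le:
  fixes x y c :: real
  assumes "\<bar>x\<bar> \<le> c" "\<bar>y\<bar> \<le> c"
  shows "\<bar>x / 2 * y\<bar> \<le> c * c"
proof -
  have "\<bar>x / 2 * y\<bar> \<le> \<bar>x\<bar> * \<bar>y\<bar>" by (simp add: abs_mult)
  also have "\<dots> \<le> c * c" using assms by (intro mult_mono) auto
  finally show ?thesis .
qed

lemma line_integral_trapezoid:
  assumes lip: "M-lipschitz_on {0..1} \<sigma>"
  shows "trapezoid_sum \<sigma> \<longlonglongrightarrow> line_integral (Re \<circ> \<sigma>) (Im \<circ> \<sigma>)"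
proof -
  have M: "M \<ge> 0" using lip by (rule lipschitz_on_nonneg)
  have X: "M-lipschitz_on {0..1} (Re \<circ> \<sigma>)" "M-lipschitz_on {0..1} (Im \<circ> \<sigma>)"
    using lip abs_Re_le_cmod abs_Im_le_cmod unfolding lipschitz_on_def o_def dist_norm real_norm_def
    by (metis minus_complex.simps order_trans)+
  have "(\<lambda>n. trapezoid_sum \<sigma> n - riemann_sum (Re \<circ> \<sigma>) (Im \<circ> \<sigma>) n) \<longlonglongrightarrow> 0"
  proof (rule tendsto_rabs_zero_cancel, rule real_tendsto_sandwich[where f="\<lambda>_. 0"])
    show "(\<lambda>n. M\<^sup>2 / real n) \<longlonglongrightarrow> 0" by (rule lim_const_over_n)
    show "\<forall>\<^sub>F n in sequentially. \<bar>trapezoid_sum \<sigma> n - riemann_sum (Re \<circ> \<sigma>) (Im \<circ> \<sigma>) n\<bar> \<le> M\<^sup>2 / real n"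
      using eventually_gt_at_top[of 0]
    proof eventually_elim
      case (elim n)
      have "\<bar>trapezoid_sum \<sigma> n - riemann_sum (Re \<circ> \<sigma>) (Im \<circ> \<sigma>) n\<bar> =
        \<bar>\<Sum>i<n. (Re (\<sigma> (Suc i / n)) - Re (\<sigma> (i / n))) / 2 * (Im (\<sigma> (Suc i / n)) - Im (\<sigma> (i / n)))\<bar>"
        unfolding trapezoid_sum_def riemann_sum_def sum_subtractf[symmetric]
        by (intro arg_cong[where f=abs] sum.cong) (auto simp: field_simps)
      also have "\<dots> \<le> (\<Sum>i<n. (M * (1 / n)) * (M * (1 / n)))"
      proof (intro order.trans[OF sum_abs] sum_mono)
        fix i assume i: "i \<in> {..<n}"
        then have g: "Suc i / n \<in> {0..1}" "i / n \<in> {0..1}" by auto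
        have d: "\<bar>Suc i / n - i / n\<bar> = 1 / n" using elim by (simp add: field_simps)
        have "\<bar>Re (\<sigma> (Suc i / n)) - Re (\<sigma> (i / n))\<bar> \<le> M * (1 / n)"
          "\<bar>Im (\<sigma> (Suc i / n)) - Im (\<sigma> (i / n))\<bar> \<le> M * (1 / n)"
          using lipschitz_onD[OF X(1) g] lipschitz_onD[OF X(2) g] unfolding dist_real_def d by auto
        then show "\<bar>(Re (\<sigma> (Suc i / n)) - Re (\<sigma> (i / n))) / 2 * (Im (\<sigma> (Suc i / n)) - Im (\<sigma> (i / n)))\<bar>
          \<le> (M * (1 / n)) * (M * (1 / n))" by (rule abs_half_mult_le)
      qed
      also have "\<dots> = M\<^sup>2 / n" using elim by (simp add: power2_eq_square)
      finally show ?case .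
    qed
  qed auto
  from tendsto_add[OF this riemann_sum_tendsto[OF X]] show ?thesis by simp
qed

text \<open>
  The \<open>1\<close>-gon of a closed curve is a single point and does not wind around anything, so the
  corrections add up to the winding number of the \<open>2^k\<close>-gon.  The points on the edges,
  where winding numbers are meaningless, are excluded.
\<close>

lemma partial_sums_corner_correction:
  fixes \<sigma> :: "real \<Rightarrow> complex"
  assumes loop: "\<sigma> 0 = \<sigma> 1"
    and off: "\<And>a b. a \<in> \<rat> \<Longrightarrow> b \<in> \<rat> \<Longrightarrow> w \<notin> closed_segment (\<sigma> a) (\<sigma> b)"
  shows "of_real (\<Sum>j<k. corner_correction \<sigma> j w)
       = (\<Sum>i<2^k. winding_number (linepath (\<sigma> (i / 2^k)) (\<sigma> (Suc i / 2^k))) w)"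
proof (induction k)
  case 0
  have "w \<noteq> \<sigma> 1" using off[of 1 1] by simp
  then show ?case using loop by (simp add: winding_number_zero_const)
next
  case (Suc k)
  let ?wn = "\<lambda>a b. winding_number (linepath (\<sigma> a) (\<sigma> b)) w"
  have grid: "real (2 * i) / 2^Suc k = real i / 2^k" for i by simp
  have grid': "real (Suc (Suc (2 * i))) / 2^Suc k = real (Suc i) / 2^k" for i by (simp add: field_simps)
  have rat: "real i / 2 ^ k \<in> \<rat>" for i k :: nat
    by (intro Rats_divide) simp_all
  have tri: "?wn (i / 2^k) (Suc i / 2^k) + of_real (sgn (signed_area2 (\<sigma> (i / 2^k)) (\<sigma> (Suc (2 * i) / 2^Suc k)) (\<sigma> (Suc i / 2^k))) *
     indicator (convex hull {\<sigma> (i / 2^k), \<sigma> (Suc (2 * i) / 2^Suc k), \<sigma> (Suc i / 2^k)}) w)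
     = ?wn (i / 2^k) (Suc (2 * i) / 2^Suc k) + ?wn (Suc (2 * i) / 2^Suc k) (Suc i / 2^k)" for i :: nat
  proof -
    have off': "w \<notin> closed_segment (\<sigma> (i / 2^k)) (\<sigma> (Suc (2 * i) / 2^Suc k))"
      "w \<notin> closed_segment (\<sigma> (Suc (2 * i) / 2^Suc k)) (\<sigma> (Suc i / 2^k))"
      "w \<notin> closed_segment (\<sigma> (Suc i / 2^k)) (\<sigma> (i / 2^k))"
      by (intro off rat)+
    have "?wn (Suc i / 2^k) (i / 2^k) = - ?wn (i / 2^k) (Suc i / 2^k)"
      using winding_number_reversepath[of "linepath (\<sigma> (i / 2^k)) (\<sigma> (Suc i / 2^k))" w] off'(3)
      by (simp add: closed_segment_commute)
    with winding_number_triangle_boundary[OF off'] show ?thesis by (simp add: algebra_simps)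
  qed
  have "of_real (\<Sum>j<Suc k. corner_correction \<sigma> j w) = (\<Sum>i<2^k. ?wn (i / 2^k) (Suc i / 2^k)) + of_real (corner_correction \<sigma> k w)"
    using Suc.IH by simp
  also have "\<dots> = (\<Sum>i<2^k. ?wn (i / 2^k) (Suc (2 * i) / 2^Suc k) + ?wn (Suc (2 * i) / 2^Suc k) (Suc i / 2^k))"
    unfolding corner_correction_def Let_def of_real_sum sum.distrib[symmetric] tri ..
  also have "\<dots> = (\<Sum>i<2 * 2^k. ?wn (i / 2^Suc k) (Suc i / 2^Suc k))"
    unfolding sum_lessThan_double grid grid' ..
  finally show ?case by simp
qed

text \<open>
  The interval is embedded in the complex plane as a null set, since Lipschitz maps between spaces of the
  same dimension preserve null sets.
\<close>

lemma negligible_lipschitz_path_image: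
  fixes \<sigma> :: "real \<Rightarrow> complex"
  assumes lip: "M-lipschitz_on {0..1} \<sigma>"
  shows "negligible (path_image \<sigma>)"
proof -
  let ?S = "{z. z \<bullet> \<i> = 0} \<inter> {z. Re z \<in> {0..1}}"
  have "negligible ((\<lambda>z. \<sigma> (Re z)) ` ?S)"
  proof (rule negligible_locally_Lipschitz_image)
    show "negligible ?S" by (rule negligible_Int, rule disjI1, rule negligible_standard_hyperplane) (simp add: Basis_complex_def)
    fix x assume x: "x \<in> ?S"
    have "norm (\<sigma> (Re y) - \<sigma> (Re x)) \<le> M * norm (y - x)" if "y \<in> ?S" for y
    proof -
      have "norm (\<sigma> (Re y) - \<sigma> (Re x)) \<le> M * \<bar>Re y - Re x\<bar>"
        using lipschitz_onD[OF lip, of "Re y" "Re x"] x that by (simp add: dist_norm)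
      also have "\<dots> \<le> M * norm (y - x)"
        using abs_Re_le_cmod[of "y - x"] lipschitz_on_nonneg[OF lip] by (intro mult_left_mono) auto
      finally show ?thesis .
    qed
    then show "\<exists>T B. open T \<and> x \<in> T \<and> (\<forall>y\<in>?S \<inter> T. norm (\<sigma> (Re y) - \<sigma> (Re x)) \<le> B * norm (y - x))"
      by (intro exI[of _ UNIV] exI[of _ M]) auto
  qed simp
  moreover have "path_image \<sigma> \<subseteq> (\<lambda>z. \<sigma> (Re z)) ` ?S"
  proof
    fix z assume "z \<in> path_image \<sigma>"
    then obtain t where "t \<in> {0..1}" "z = \<sigma> t" by (auto simp: path_image_def)
    then show "z \<in> (\<lambda>z. \<sigma> (Re z)) ` ?S" by (intro image_eqI[of _ _ "of_real t"]) auto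
  qed
  ultimately show ?thesis by (rule negligible_subset)
qed

text \<open>
  Green's formula for closed Lipschitz curves that may intersect themselves: each point of the plane is
  counted with its winding number.  The formula is elementary for inscribed polygons; the series of corner
  corrections is integrated term by term.  Almost everywhere only finitely many of its terms are nonzero.
  The function \<open>W\<close> is a measurable representative of the winding number.
\<close>

theorem line_integral_eq_winding_integral:
  fixes \<sigma> :: "real \<Rightarrow> complex"
  assumes lip: "M-lipschitz_on {0..1} \<sigma>" and loop: "\<sigma> 0 = \<sigma> 1"
  obtains W where "integrable lborel W"
    and "AE w in lborel. w \<notin> path_image \<sigma> \<and> winding_number \<sigma> w = of_real (W w)"
    and "(\<integral>w. W w \<partial>lborel) = line_integral (Re \<circ> \<sigma>) (Im \<circ> \<sigma>)"
proof -
  let ?c = "corner_correction \<sigma>"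
  define W where "W w = (\<Sum>j. ?c j w)" for w
  have seg: "negligible (closed_segment a b)" for a b :: complex
  proof -
    have "(norm (b - a))-lipschitz_on {0..1} (linepath a b)"
    proof (rule lipschitz_onI)
      fix x y :: real
      have "linepath a b x - linepath a b y = (x - y) *\<^sub>R (b - a)" by (simp add: linepath_def algebra_simps)
      then show "dist (linepath a b x) (linepath a b y) \<le> norm (b - a) * dist x y"
        by (simp add: dist_norm mult.commute)
    qed simp
    from negligible_lipschitz_path_image[OF this] show ?thesis by simp
  qed
  have "negligible (\<Union>b\<in>\<rat>. closed_segment (\<sigma> a) (\<sigma> b))" for a
    by (rule negligible_countable_Union[OF countable_image[OF countable_rat]]) (auto simp: seg)
  then have "negligible (\<Union>a\<in>\<rat>. \<Union>b\<in>\<rat>. closed_segment (\<sigma> a) (\<sigma> b))"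
    by (intro negligible_countable_Union[OF countable_image[OF countable_rat]]) blast
  with negligible_lipschitz_path_image[OF lip]
  have "negligible (path_image \<sigma> \<union> (\<Union>a\<in>\<rat>. \<Union>b\<in>\<rat>. closed_segment (\<sigma> a) (\<sigma> b)))"
    by (rule negligible_Un)
  then have "AE w in lebesgue. w \<notin> path_image \<sigma> \<union> (\<Union>a\<in>\<rat>. \<Union>b\<in>\<rat>. closed_segment (\<sigma> a) (\<sigma> b))"
    unfolding negligible_iff_null_sets by (rule AE_not_in)
  then have AE: "AE w in lborel. w \<notin> path_image \<sigma> \<and> (\<forall>a\<in>\<rat>. \<forall>b\<in>\<rat>. w \<notin> closed_segment (\<sigma> a) (\<sigma> b))"
    by (simp add: AE_completion_iff)
  have ev: "\<forall>\<^sub>F k in sequentially. of_real (\<Sum>j<k. ?c j w) = winding_number \<sigma> w"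
    if "w \<notin> path_image \<sigma>" "\<forall>a\<in>\<rat>. \<forall>b\<in>\<rat>. w \<notin> closed_segment (\<sigma> a) (\<sigma> b)" for w
  proof -
    have "filterlim (\<lambda>k. 2 ^ k :: nat) sequentially sequentially"
      by (rule filterlim_subseq) (simp add: strict_mono_def)
    from filterlim_iff[THEN iffD1, OF this, rule_format, OF winding_number_inscribed_polygon[OF lip that(1)]]
    show ?thesis
    proof eventually_elim
      case (elim k)
      then show ?case using partial_sums_corner_correction[OF loop, of w k] that(2) by simp
    qed
  qed
  have sums: "summable (\<lambda>j. norm (?c j w)) \<and> winding_number \<sigma> w = of_real (W w)"
    if w: "w \<notin> path_image \<sigma>" "\<forall>a\<in>\<rat>. \<forall>b\<in>\<rat>. w \<notin> closed_segment (\<sigma> a) (\<sigma> b)" for w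
  proof -
    obtain K where K: "\<And>k. k \<ge> K \<Longrightarrow> of_real (\<Sum>j<k. ?c j w) = winding_number \<sigma> w"
      using ev[OF w] unfolding eventually_sequentially by blast
    have zero: "?c j w = 0" if "j \<ge> K" for j
    proof -
      have "complex_of_real (\<Sum>j<Suc j. ?c j w) = of_real (\<Sum>j<j. ?c j w)" using K[of j] K[of "Suc j"] that by simp
      then show ?thesis unfolding of_real_eq_iff by simp
    qed
    have "W w = (\<Sum>j<K. ?c j w)"
      unfolding W_def using zero by (intro suminf_finite) auto
    moreover have "summable (\<lambda>j. norm (?c j w))"
      using zero by (intro summable_finite[of "{..<K}"]) auto
    ultimately show ?thesis using K[of K] by simp
  qed
  have AEs: "AE w in lborel. summable (\<lambda>j. norm (?c j w))"
    by (rule eventually_mono[OF AE]) (elim conjE, rule conjunct1[OF sums])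
  have int_sums: "summable (\<lambda>j. \<integral>w. norm (?c j w) \<partial>lborel)"
  proof (rule summable_comparison_test'[where N=0])
    have "summable (\<lambda>j. (1 / 2 :: real) ^ j)" by (rule summable_geometric) simp
    then show "summable (\<lambda>j. M\<^sup>2 * (1 / 2) ^ j)" by (rule summable_mult)
    fix j :: nat
    have "0 \<le> (\<integral>w. norm (?c j w) \<partial>lborel)" by (rule Bochner_Integration.integral_nonneg) (rule norm_ge_zero)
    then show "norm (\<integral>w. norm (?c j w) \<partial>lborel) \<le> M\<^sup>2 * (1 / 2) ^ j"
      using integral_abs_corner_correction[OF lip, of j] unfolding real_norm_def by linarith
  qed
  note series = integral_corner_correction(1) AEs int_sums
  show ?thesis
  proof
    show "integrable lborel W" unfolding W_def[abs_def] by (rule integrable_suminf[OF series])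
    show "AE w in lborel. w \<notin> path_image \<sigma> \<and> winding_number \<sigma> w = of_real (W w)"
      by (rule eventually_mono[OF AE]) (elim conjE, intro conjI conjunct2[OF sums])
    have part: "(\<Sum>j<k. \<integral>w. ?c j w \<partial>lborel) = trapezoid_sum \<sigma> (2^k)" for k
    proof (induction k)
      case 0 show ?case using loop by (simp add: trapezoid_sum_def)
    qed (simp add: integral_corner_correction)
    have "(\<lambda>k. trapezoid_sum \<sigma> (2^k)) \<longlonglongrightarrow> (\<integral>w. W w \<partial>lborel)"
      using sums_integral[OF series] unfolding sums_def part W_def .
    moreover have "(\<lambda>k. trapezoid_sum \<sigma> (2^k)) \<longlonglongrightarrow> line_integral (Re \<circ> \<sigma>) (Im \<circ> \<sigma>)"
      using LIMSEQ_subseq_LIMSEQ[OF line_integral_trapezoid[OF lip], of "\<lambda>k. 2^k"]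
      by (simp add: o_def strict_mono_def)
    ultimately show "(\<integral>w. W w \<partial>lborel) = line_integral (Re \<circ> \<sigma>) (Im \<circ> \<sigma>)"
      by (rule LIMSEQ_unique)
  qed
qed

section \<open>Line integrals along closed curves\<close>

definition lipschitz_loop :: "(real \<Rightarrow> real) \<Rightarrow> bool" where
  "lipschitz_loop X \<longleftrightarrow> X 0 = X 1 \<and> (\<exists>M. M-lipschitz_on {0..1} X)"

lemma lipschitz_loop_add:
  assumes "lipschitz_loop X" "lipschitz_loop Y"
  shows "lipschitz_loop (\<lambda>x. X x + Y x)"
  using assms lipschitz_on_add unfolding lipschitz_loop_def by metis

lemma lipschitz_loop_cmult:
  assumes "lipschitz_loop X"
  shows "lipschitz_loop (\<lambda>x. c * X x)"
  using assms lipschitz_on_cmult_real unfolding lipschitz_loop_def by metis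

lemma lipschitz_loop_compose:
  assumes "lipschitz_loop X" "\<And>x y. \<bar>h x - h y :: real\<bar> \<le> \<bar>x - y\<bar>"
  shows "lipschitz_loop (\<lambda>x. h (X x))"
proof -
  obtain M where "M-lipschitz_on {0..1} X" "X 0 = X 1" using assms(1) by (auto simp: lipschitz_loop_def)
  then have "M-lipschitz_on {0..1} (\<lambda>x. h (X x))"
    using assms(2) unfolding lipschitz_on_def dist_real_def by (meson order_trans)
  then show ?thesis using \<open>X 0 = X 1\<close> by (auto simp: lipschitz_loop_def)
qed

lemma riemann_sum_tendsto_loop:
  assumes "lipschitz_loop X" "lipschitz_loop Y"
  shows "riemann_sum X Y \<longlonglongrightarrow> line_integral X Y"
  using assms riemann_sum_tendsto unfolding lipschitz_loop_def by blast

lemma line_integral_add_scaled_left: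
  assumes "lipschitz_loop X" "lipschitz_loop X'" "lipschitz_loop Y"
  shows "line_integral (\<lambda>x. X x + c * X' x) Y = line_integral X Y + c * line_integral X' Y"
proof (rule LIMSEQ_unique)
  show "riemann_sum (\<lambda>x. X x + c * X' x) Y \<longlonglongrightarrow> line_integral (\<lambda>x. X x + c * X' x) Y"
    by (intro riemann_sum_tendsto_loop lipschitz_loop_add lipschitz_loop_cmult assms)
  have "riemann_sum (\<lambda>x. X x + c * X' x) Y = (\<lambda>n. riemann_sum X Y n + c * riemann_sum X' Y n)"
    by (simp only: fun_eq_iff riemann_sum_def sum_distrib_left sum.distrib[symmetric] distrib_right mult.assoc simp_thms)
  then show "riemann_sum (\<lambda>x. X x + c * X' x) Y \<longlonglongrightarrow> line_integral X Y + c * line_integral X' Y"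
    using tendsto_add[OF riemann_sum_tendsto_loop[OF assms(1,3)] tendsto_mult_left[OF riemann_sum_tendsto_loop[OF assms(2,3)], of c]]
    by simp
qed

lemma line_integral_add_scaled_right:
  assumes "lipschitz_loop X" "lipschitz_loop Y" "lipschitz_loop Y'"
  shows "line_integral X (\<lambda>x. Y x + c * Y' x) = line_integral X Y + c * line_integral X Y'"
proof (rule LIMSEQ_unique)
  show "riemann_sum X (\<lambda>x. Y x + c * Y' x) \<longlonglongrightarrow> line_integral X (\<lambda>x. Y x + c * Y' x)"
    by (intro riemann_sum_tendsto_loop lipschitz_loop_add lipschitz_loop_cmult assms)
  have "x * ((y1 + c * z1) - (y0 + c * z0)) = x * (y1 - y0) + c * (x * (z1 - z0))" for x y0 y1 z0 z1 :: real
    by (simp add: algebra_simps)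
  then have "riemann_sum X (\<lambda>x. Y x + c * Y' x) = (\<lambda>n. riemann_sum X Y n + c * riemann_sum X Y' n)"
    by (simp only: fun_eq_iff riemann_sum_def sum_distrib_left sum.distrib[symmetric] simp_thms)
  then show "riemann_sum X (\<lambda>x. Y x + c * Y' x) \<longlonglongrightarrow> line_integral X Y + c * line_integral X Y'"
    using tendsto_add[OF riemann_sum_tendsto_loop[OF assms(1,2)] tendsto_mult_left[OF riemann_sum_tendsto_loop[OF assms(1,3)], of c]]
    by simp
qed

text \<open>
  \<open>P\<close> is a primitive of \<open>h\<close>, and \<open>P \<circ> u\<close> is one of the integrand; it takes the same value at both ends.
\<close>

lemma line_integral_exact:
  fixes P h :: "real \<Rightarrow> real"
  assumes u: "lipschitz_loop u" and P: "\<And>x y. \<bar>P y - P x - h x * (y - x)\<bar> \<le> (y - x)\<^sup>2"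
  shows "line_integral (\<lambda>x. h (u x)) u = 0"
proof -
  obtain M where M: "M-lipschitz_on {0..1} u" "u 0 = u 1" using u by (auto simp: lipschitz_loop_def)
  have "line_integral (\<lambda>x. h (u x)) u = P (u 1) - P (u 0)"
  proof (rule line_integral_primitive)
    fix a b :: real assume ab: "0 \<le> a" "a \<le> b" "b \<le> 1"
    have "\<bar>u b - u a\<bar> \<le> M * (b - a)"
      using lipschitz_onD[OF M(1), of b a] ab by (simp add: dist_real_def)
    then have "(u b - u a)\<^sup>2 \<le> (M * (b - a))\<^sup>2" by (rule power2_le_iff_abs_le[THEN iffD2, rotated]) (use ab lipschitz_on_nonneg[OF M(1)] in simp)
    with P[of "u b" "u a"] show "\<bar>P (u b) - P (u a) - h (u a) * (u b - u a)\<bar> \<le> M\<^sup>2 * (b - a)\<^sup>2"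
      unfolding power_mult_distrib by linarith
  qed
  then show ?thesis using M by simp
qed

lemma line_integral_self:
  assumes "lipschitz_loop X"
  shows "line_integral X X = 0"
proof (rule line_integral_exact[OF assms, of "\<lambda>x. x\<^sup>2 / 2" "\<lambda>x. x", simplified])
  fix x y :: real
  have "y\<^sup>2 / 2 - x\<^sup>2 / 2 - x * (y - x) = (y - x)\<^sup>2 / 2"
    by (simp add: power2_eq_square field_simps)
  then show "\<bar>y\<^sup>2 / 2 - x\<^sup>2 / 2 - x * (y - x)\<bar> \<le> (y - x)\<^sup>2"
    using zero_le_power2[of "y - x"] by linarith
qed

text \<open>
  Integration by parts along a loop, by polarization of \<open>line_integral_self\<close>.
\<close>

lemma line_integral_swap:
  assumes X: "lipschitz_loop X" and Y: "lipschitz_loop Y"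
  shows "line_integral Y X = - line_integral X Y"
proof -
  have XY: "lipschitz_loop (\<lambda>x. X x + 1 * Y x)" by (intro lipschitz_loop_add lipschitz_loop_cmult X Y)
  have "0 = line_integral (\<lambda>x. X x + 1 * Y x) (\<lambda>x. X x + 1 * Y x)" using line_integral_self[OF XY] by simp
  also have "\<dots> = line_integral X X + line_integral X Y + line_integral Y X + line_integral Y Y"
    unfolding line_integral_add_scaled_left[OF X Y XY] line_integral_add_scaled_right[OF X X Y] line_integral_add_scaled_right[OF Y X Y] by simp
  finally show ?thesis using line_integral_self[OF X] line_integral_self[OF Y] by simp
qed


section \<open>The damped oscillator and its energy\<close>

text \<open>
  The continuous-time dynamics in normalized form: \<open>P = f/L\<close>, \<open>h = P'\<close>, and \<open>m\<close> the modulus of strong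
  convexity, here \<open>1/\<kappa>\<close>.
\<close>

locale damped_oscillator =
  fixes P h :: "real \<Rightarrow> real" and d \<beta> m :: real
  assumes P_deriv: "(P has_real_derivative h x) (at x)"
    and h_lipschitz: "\<bar>h x - h y\<bar> \<le> \<bar>x - y\<bar>"
    and strongly_convex: "P y + h y * (x - y) + m / 2 * (x - y)\<^sup>2 \<le> P x"
    and P0: "P 0 = 0" and h0: "h 0 = 0"
    and m_pos: "m > 0" and d_pos: "d > 0" and \<beta>_nonneg: "\<beta> \<ge> 0"
begin

definition force :: "real \<times> real \<Rightarrow> real" where
  "force z = - 2 * d * snd z - h (fst z + \<beta> * snd z)"

definition field :: "real \<times> real \<Rightarrow> real \<times> real" where
  "field z = (snd z, force z)"

definition H :: "real \<times> real \<Rightarrow> real" where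
  "H z = (snd z)\<^sup>2 / 2 + P (fst z)"

lemma h_strongly_mono: "m * (x - y)\<^sup>2 \<le> (h x - h y) * (x - y)"
  using strongly_convex[of y x] strongly_convex[of x y] by (simp add: power2_commute algebra_simps)

lemma P_taylor: "\<bar>P y - P x - h x * (y - x)\<bar> \<le> (y - x)\<^sup>2"
proof (cases "x = y")
  case False
  obtain z where z: "\<bar>z - x\<bar> \<le> \<bar>y - x\<bar>" "P y - P x = (y - x) * h z"
  proof (cases "x < y")
    case True
    obtain z where "x < z" "z < y" "P y - P x = (y - x) * h z"
      using MVT2[OF True] P_deriv by blast
    then show ?thesis by (intro that[of z]) auto
  next
    case yx: False
    then have "y < x" using False by simp
    then obtain z where "y < z" "z < x" "P x - P y = (x - y) * h z"
      using MVT2 P_deriv by blast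
    then show ?thesis by (intro that[of z]) (auto simp: algebra_simps)
  qed
  have "P y - P x - h x * (y - x) = (h z - h x) * (y - x)" using z(2) by (simp add: algebra_simps)
  then have "\<bar>P y - P x - h x * (y - x)\<bar> = \<bar>h z - h x\<bar> * \<bar>y - x\<bar>" by (simp add: abs_mult)
  also have "\<dots> \<le> \<bar>y - x\<bar> * \<bar>y - x\<bar>"
    using h_lipschitz[of z x] z(1) by (intro mult_right_mono) auto
  finally show ?thesis by (simp add: power2_eq_square)
qed simp

definition rate :: real where "rate = 1 + 2 * d + \<beta>"

lemma rate_pos: "rate > 0" using d_pos \<beta>_nonneg by (simp add: rate_def)

text \<open>
  Half the derivative of the squared distance of two solutions is this inner product, so it controls their
  separation from above and from below.
\<close>

lemma field_growth: "\<bar>(z - z') \<bullet> (field z - field z')\<bar> \<le> rate * (norm (z - z'))\<^sup>2"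
proof -
  obtain q p where z: "z = (q, p)" by (cases z)
  obtain q' p' where z': "z' = (q', p')" by (cases z')
  define a b k where "a = q - q'" and "b = p - p'" and "k = h (q + \<beta> * p) - h (q' + \<beta> * p')"
  have "\<bar>k\<bar> \<le> \<bar>a + \<beta> * b\<bar>"
    using h_lipschitz[of "q + \<beta> * p" "q' + \<beta> * p'"] by (simp add: a_def b_def k_def algebra_simps)
  also have "\<dots> \<le> \<bar>a\<bar> + \<beta> * \<bar>b\<bar>" using \<beta>_nonneg abs_triangle_ineq[of a "\<beta> * b"] by (simp add: abs_mult)
  finally have k: "\<bar>k\<bar> \<le> \<bar>a\<bar> + \<beta> * \<bar>b\<bar>" .
  have "(z - z') \<bullet> (field z - field z') = a * b - 2 * d * (b * b) - b * k"
    by (simp add: z z' field_def force_def inner_prod_def a_def b_def k_def algebra_simps)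
  moreover have "\<bar>a * b - 2 * d * (b * b) - b * k\<bar> \<le> \<bar>a * b\<bar> + \<bar>2 * d * (b * b)\<bar> + \<bar>b * k\<bar>" by linarith
  ultimately have "\<bar>(z - z') \<bullet> (field z - field z')\<bar> \<le> \<bar>a\<bar> * \<bar>b\<bar> + 2 * d * (b * b) + \<bar>b\<bar> * \<bar>k\<bar>"
    using d_pos by (simp add: abs_mult)
  also have "\<bar>b\<bar> * \<bar>k\<bar> \<le> \<bar>b\<bar> * (\<bar>a\<bar> + \<beta> * \<bar>b\<bar>)" using k by (intro mult_left_mono) auto
  also have "\<bar>a\<bar> * \<bar>b\<bar> + 2 * d * (b * b) + \<bar>b\<bar> * (\<bar>a\<bar> + \<beta> * \<bar>b\<bar>) = 2 * (\<bar>a\<bar> * \<bar>b\<bar>) + (2 * d + \<beta>) * (b * b)"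
    by (simp add: algebra_simps)
  also have "\<dots> \<le> (a\<^sup>2 + b\<^sup>2) + (2 * d + \<beta>) * (a\<^sup>2 + b\<^sup>2)"
  proof (rule add_mono)
    show "2 * (\<bar>a\<bar> * \<bar>b\<bar>) \<le> a\<^sup>2 + b\<^sup>2"
      using sum_squares_bound[of "\<bar>a\<bar>" "\<bar>b\<bar>"] by simp
    show "(2 * d + \<beta>) * (b * b) \<le> (2 * d + \<beta>) * (a\<^sup>2 + b\<^sup>2)"
      using d_pos \<beta>_nonneg by (intro mult_left_mono) (auto simp: power2_eq_square)
  qed
  also have "\<dots> = rate * (norm (z - z'))\<^sup>2"
    by (simp add: rate_def z z' a_def b_def norm_Pair algebra_simps)
  finally show ?thesis by simp
qed

lemma force_lipschitz: "\<bar>force z - force z'\<bar> \<le> rate * norm (z - z')"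
proof -
  have f: "\<bar>fst z - fst z'\<bar> \<le> norm (z - z')" "\<bar>snd z - snd z'\<bar> \<le> norm (z - z')"
    using norm_fst_le[of "fst z - fst z'" "snd z - snd z'"] norm_snd_le[of "snd z - snd z'" "fst z - fst z'"]
    by (simp_all add: minus_prod_def)
  have "\<bar>h (fst z + \<beta> * snd z) - h (fst z' + \<beta> * snd z')\<bar> \<le> \<bar>(fst z - fst z') + \<beta> * (snd z - snd z')\<bar>"
    using h_lipschitz[of "fst z + \<beta> * snd z" "fst z' + \<beta> * snd z'"] by (simp add: algebra_simps)
  also have "\<dots> \<le> \<bar>fst z - fst z'\<bar> + \<beta> * \<bar>snd z - snd z'\<bar>"
    using \<beta>_nonneg abs_triangle_ineq[of "fst z - fst z'" "\<beta> * (snd z - snd z')"] by (simp add: abs_mult)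
  finally have hb: "\<bar>h (fst z + \<beta> * snd z) - h (fst z' + \<beta> * snd z')\<bar> \<le> \<bar>fst z - fst z'\<bar> + \<beta> * \<bar>snd z - snd z'\<bar>" .
  have "\<bar>force z - force z'\<bar> \<le> 2 * d * \<bar>snd z - snd z'\<bar> + \<bar>fst z - fst z'\<bar> + \<beta> * \<bar>snd z - snd z'\<bar>"
  proof -
    have "force z - force z' = - (2 * d * (snd z - snd z')) - (h (fst z + \<beta> * snd z) - h (fst z' + \<beta> * snd z'))"
      by (simp add: force_def algebra_simps)
    moreover have "\<bar>2 * d * (snd z - snd z')\<bar> = 2 * d * \<bar>snd z - snd z'\<bar>" using d_pos by (simp add: abs_mult)
    moreover note hb
    ultimately show ?thesis by linarith
  qed
  also have "\<dots> \<le> 2 * d * norm (z - z') + norm (z - z') + \<beta> * norm (z - z')"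
    using f d_pos \<beta>_nonneg by (intro add_mono mult_left_mono) auto
  also have "\<dots> = rate * norm (z - z')" by (simp add: rate_def algebra_simps)
  finally show ?thesis .
qed

text \<open>
  The area of the image of a region under this map is the integral of \<open>h' (q + \<beta> p)\<close> over the region, which is,
  up to the factor \<open>- \<beta>\<close>, the contribution of \<open>h\<close> to the integral of the divergence of the vector field.
\<close>

definition shear :: "real \<times> real \<Rightarrow> complex" where
  "shear z = Complex (h (fst z + \<beta> * snd z)) (snd z)"

definition plane :: "real \<times> real \<Rightarrow> complex" where
  "plane z = Complex (fst z) (snd z)"

text \<open>
  Strong monotonicity forces \<open>\<bar>h x\<bar> \<ge> m \<bar>x\<bar>\<close> with the sign of \<open>x\<close>.
\<close>

lemma h_surj: "\<exists>x. h x = y"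
proof -
  have cont: "continuous_on S h" for S
    using h_lipschitz by (intro lipschitz_on_continuous_on[of 1] lipschitz_onI) (auto simp: dist_real_def)
  define a where "a = \<bar>y\<bar> / m"
  have a: "a \<ge> 0" "m * a = \<bar>y\<bar>" using m_pos by (auto simp: a_def)
  have "h (- a) \<le> y \<and> y \<le> h a"
  proof (cases "a = 0")
    case True
    then show ?thesis using a h0 by simp
  next
    case False
    then have pos: "a > 0" using a by simp
    have "\<bar>y\<bar> * a \<le> h a * a" "\<bar>y\<bar> * a \<le> (- h (- a)) * a"
      using h_strongly_mono[of a 0] h_strongly_mono[of "- a" 0] h0 unfolding a(2)[symmetric]
      by (auto simp: power2_eq_square)
    then have "\<bar>y\<bar> \<le> h a" "\<bar>y\<bar> \<le> - h (- a)"
      using mult_right_le_imp_le[OF _ pos] by blast+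
    then show ?thesis by linarith
  qed
  then show ?thesis using IVT'[of h "- a" y a] cont a by auto
qed

lemma h_inj: "h x = h y \<Longrightarrow> x = y"
  using h_strongly_mono[of x y] m_pos by (simp add: mult_le_0_iff)

lemma shear_inj: "shear z = shear z' \<Longrightarrow> z = z'"
  by (auto simp: shear_def prod_eq_iff dest: h_inj)

lemma shear_surj: "\<exists>z. shear z = w"
proof -
  obtain u where "h u = Re w" using h_surj by blast
  then show ?thesis by (intro exI[of _ "(u - \<beta> * Im w, Im w)"]) (simp add: shear_def complex_eq_iff)
qed

lemma shear_lipschitz: "norm (shear z - shear z') \<le> (2 + \<beta>) * norm (z - z')"
proof -
  let ?a = "fst z - fst z'" and ?b = "snd z - snd z'"
  have f: "\<bar>?a\<bar> \<le> norm (z - z')" "\<bar>?b\<bar> \<le> norm (z - z')"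
    using norm_fst_le[of ?a ?b] norm_snd_le[of ?b ?a] by (simp_all add: minus_prod_def)
  have "\<bar>h (fst z + \<beta> * snd z) - h (fst z' + \<beta> * snd z')\<bar> \<le> \<bar>?a + \<beta> * ?b\<bar>"
    using h_lipschitz[of "fst z + \<beta> * snd z" "fst z' + \<beta> * snd z'"] by (simp add: algebra_simps)
  also have "\<dots> \<le> \<bar>?a\<bar> + \<beta> * \<bar>?b\<bar>"
    using \<beta>_nonneg abs_triangle_ineq[of ?a "\<beta> * ?b"] by (simp add: abs_mult)
  also have "\<dots> \<le> norm (z - z') + \<beta> * norm (z - z')"
    using f \<beta>_nonneg by (intro add_mono mult_left_mono) auto
  finally have hb: "\<bar>h (fst z + \<beta> * snd z) - h (fst z' + \<beta> * snd z')\<bar> \<le> (1 + \<beta>) * norm (z - z')"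
    by (simp add: algebra_simps)
  have "norm (shear z - shear z') \<le> \<bar>Re (shear z - shear z')\<bar> + \<bar>Im (shear z - shear z')\<bar>"
    by (rule cmod_le)
  also have "\<dots> \<le> (1 + \<beta>) * norm (z - z') + norm (z - z')"
    using hb f by (simp add: shear_def)
  finally show ?thesis by (simp add: algebra_simps)
qed

lemma plane_norm: "norm (plane z - plane z') = norm (z - z')"
  by (simp add: plane_def cmod_def norm_prod_def)

text \<open>
  Convexity of the energy: its graph lies above the tangent planes.
\<close>

lemma H_tangent: "H z + (snd z * (snd z' - snd z) + h (fst z) * (fst z' - fst z)) \<le> H z'"
proof -
  have "P (fst z) + h (fst z) * (fst z' - fst z) \<le> P (fst z')"
    using strongly_convex[of "fst z" "fst z'"] m_pos
    by (smt (verit) divide_nonneg_pos mult_nonneg_nonneg zero_le_power2)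
  moreover have "(snd z)\<^sup>2 / 2 + snd z * (snd z' - snd z) \<le> (snd z')\<^sup>2 / 2"
    using zero_le_power2[of "snd z' - snd z"] by (simp add: power2_eq_square algebra_simps)
  ultimately show ?thesis by (simp add: H_def)
qed

lemma convex_sublevel: "convex {w. H (Re w, Im w) \<le> c}"
  unfolding convex_alt
proof (intro ballI allI impI)
  fix x y and u :: real
  assume x: "x \<in> {w. H (Re w, Im w) \<le> c}" and y: "y \<in> {w. H (Re w, Im w) \<le> c}" and u: "0 \<le> u \<and> u \<le> 1"
  define z where "z = (1 - u) *\<^sub>R x + u *\<^sub>R y"
  \<comment> \<open>The linear part of the tangent at \<open>z\<close>; it averages to zero over \<open>x\<close> and \<open>y\<close>.\<close>
  define l where "l w = Im z * (Im w - Im z) + h (Re z) * (Re w - Re z)" for w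
  have t: "H (Re z, Im z) + l x \<le> c" "H (Re z, Im z) + l y \<le> c"
    using H_tangent[of "(Re z, Im z)" "(Re x, Im x)"] H_tangent[of "(Re z, Im z)" "(Re y, Im y)"] x y
    by (auto simp: l_def)
  have "(1 - u) * l x + u * l y = Im z * ((1 - u) * Im x + u * Im y - Im z) + h (Re z) * ((1 - u) * Re x + u * Re y - Re z)"
    unfolding l_def by (simp add: algebra_simps)
  also have "\<dots> = 0" by (simp add: z_def)
  finally have "H (Re z, Im z) = (1 - u) * (H (Re z, Im z) + l x) + u * (H (Re z, Im z) + l y)"
    by (simp add: algebra_simps)
  also have "\<dots> \<le> (1 - u) * c + u * c" using t u by (intro add_mono mult_left_mono) auto
  finally show "(1 - u) *\<^sub>R x + u *\<^sub>R y \<in> {w. H (Re w, Im w) \<le> c}"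
    by (simp add: z_def algebra_simps)
qed

end

section \<open>Energy level sets as Lipschitz loops\<close>

lemma norm_unit_vector_diff:
  "norm ((cos x, sin x) - (cos y, sin y) :: real \<times> real) \<le> 2 * \<bar>x - y\<bar>"
proof -
  have c: "norm (cos x - cos y) \<le> 1 * norm (x - y)"
    by (rule field_differentiable_bound[of UNIV cos "\<lambda>x. - sin x"]) (auto intro!: derivative_eq_intros)
  have s: "norm (sin x - sin y) \<le> 1 * norm (x - y)"
    by (rule field_differentiable_bound[of UNIV sin cos]) (auto intro!: derivative_eq_intros)
  have "norm ((cos x, sin x) - (cos y, sin y)) \<le> norm (cos x - cos y) + norm (sin x - sin y)"
    using norm_Pair_le[of "cos x - cos y" "sin x - sin y"] by simp
  then show ?thesis using c s by simp
qed

context damped_oscillator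
begin

lemma H_0: "H 0 = 0" using P0 by (simp add: H_def)

text \<open>
  Along a ray from the minimum a convex function grows at least linearly.
\<close>

lemma H_ray: "1 \<le> s \<Longrightarrow> s * H z \<le> H (s *\<^sub>R z)"
  using H_tangent[of z 0] H_tangent[of z "s *\<^sub>R z"] mult_left_mono[of "H z" "snd z * snd z + h (fst z) * fst z" "s - 1"]
  by (simp add: H_0 algebra_simps)

lemma H_growth: "H z - H z' \<le> 2 * norm z * norm (z - z')"
proof -
  have "H z - H z' \<le> snd z * (snd z - snd z') + h (fst z) * (fst z - fst z')"
    using H_tangent[of z z'] by (simp add: algebra_simps)
  also have "\<dots> \<le> \<bar>snd z\<bar> * \<bar>snd z - snd z'\<bar> + \<bar>h (fst z)\<bar> * \<bar>fst z - fst z'\<bar>"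
    by (intro add_mono) (metis abs_ge_self abs_mult)+
  also have "\<dots> \<le> norm z * norm (z - z') + norm z * norm (z - z')"
  proof (intro add_mono mult_mono)
    show "\<bar>snd z\<bar> \<le> norm z" using norm_snd_le[of "snd z" "fst z"] by simp
    show "\<bar>h (fst z)\<bar> \<le> norm z" using h_lipschitz[of "fst z" 0] h0 norm_fst_le[of "fst z" "snd z"] by simp
    show "\<bar>snd z - snd z'\<bar> \<le> norm (z - z')" "\<bar>fst z - fst z'\<bar> \<le> norm (z - z')"
      using norm_snd_le[of "snd z - snd z'" "fst z - fst z'"] norm_fst_le[of "fst z - fst z'" "snd z - snd z'"]
      by (simp_all add: minus_prod_def)
  qed auto
  finally show ?thesis by simp
qed

text \<open>
  The energy grows at least at rate \<open>c / r\<close> along the ray beyond the level set, and at most at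
  a bounded rate across rays.  Hence the radius of the level set is a Lipschitz function of the direction.
\<close>

lemma level_set_polar_lipschitz:
  assumes c: "c > 0" and level: "H (r *\<^sub>R e) = c" "H (s *\<^sub>R e') = c"
    and e: "norm e = 1" "norm e' = 1" and rs: "0 < r" "0 < s" "r \<le> B" "s \<le> B"
  shows "norm (r *\<^sub>R e - s *\<^sub>R e') \<le> (2 * B ^ 3 / c + B) * norm (e - e')"
proof -
  have main: "norm (r *\<^sub>R e - s *\<^sub>R e') \<le> (2 * B ^ 3 / c + B) * norm (e - e')"
    if level: "H (r *\<^sub>R e) = c" "H (s *\<^sub>R e') = c" and e: "norm e = 1" "norm e' = 1"
      and rs: "0 < r" "r \<le> s" "s \<le> B" for r s :: real and e e' :: "real \<times> real"
  proof -
    have B: "B > 0" using rs by linarith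
    \<comment> \<open>The comparison point has the direction of the first point and the larger radius of the second.\<close>
    have s: "s *\<^sub>R e = (s / r) *\<^sub>R (r *\<^sub>R e)" using rs by simp
    have "(s / r) * c \<le> H (s *\<^sub>R e)"
      using H_ray[of "s / r" "r *\<^sub>R e"] rs level unfolding s by simp
    moreover have "H (s *\<^sub>R e) - H (s *\<^sub>R e') \<le> 2 * norm (s *\<^sub>R e) * norm (s *\<^sub>R e - s *\<^sub>R e')"
      by (rule H_growth)
    moreover have n: "norm (s *\<^sub>R e - s *\<^sub>R e') = s * norm (e - e')"
      using rs by (simp add: scaleR_diff_right[symmetric])
    ultimately have "(s / r) * c - c \<le> 2 * s * (s * norm (e - e'))" using level e rs by simp
    then have "r * ((s / r) * c - c) \<le> r * (2 * s * (s * norm (e - e')))" using rs by (intro mult_left_mono) auto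
    also have "r * ((s / r) * c - c) = c * (s - r)" using rs by (simp add: algebra_simps)
    also have "r * (2 * s * (s * norm (e - e'))) = 2 * (r * (s * s)) * norm (e - e')" by simp
    also have "\<dots> \<le> 2 * (B * (B * B)) * norm (e - e')"
      using rs B by (intro mult_right_mono mult_left_mono mult_mono) auto
    finally have "s - r \<le> 2 * B ^ 3 / c * norm (e - e')"
      using c by (simp add: field_simps power3_eq_cube)
    moreover have "s * norm (e - e') \<le> B * norm (e - e')" using rs by (intro mult_right_mono) auto
    moreover have "norm (r *\<^sub>R e - s *\<^sub>R e') \<le> norm (r *\<^sub>R e - s *\<^sub>R e) + norm (s *\<^sub>R e - s *\<^sub>R e')"
      using norm_triangle_ineq[of "r *\<^sub>R e - s *\<^sub>R e" "s *\<^sub>R e - s *\<^sub>R e'"] by simp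
    moreover have "norm (r *\<^sub>R e - s *\<^sub>R e) = s - r"
      using rs e by (simp add: scaleR_diff_left[symmetric])
    ultimately show ?thesis unfolding n by (simp add: algebra_simps)
  qed
  show ?thesis
  proof (cases "r \<le> s")
    case True
    then show ?thesis using main[of r e s e'] assms by simp
  next
    case False
    then have "norm (s *\<^sub>R e' - r *\<^sub>R e) \<le> (2 * B ^ 3 / c + B) * norm (e' - e)"
      using main[of s e' r e] assms by simp
    then show ?thesis by (simp add: norm_minus_commute)
  qed
qed

lemma H_continuous: "continuous_on UNIV (\<lambda>w. H (Re w, Im w))"
proof -
  have "continuous_on UNIV P"
    using P_deriv DERIV_isCont by (auto simp: continuous_on_eq_continuous_at)
  then show ?thesis
    unfolding H_def by (auto intro!: continuous_intros continuous_on_compose2[of UNIV P])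
qed

lemma sublevel_bounded: "bounded {w. H (Re w, Im w) < c}"
proof (rule boundedI)
  fix w assume "w \<in> {w. H (Re w, Im w) < c}"
  then have *: "(Im w)\<^sup>2 / 2 + P (Re w) < c" by (simp add: H_def)
  have P: "m / 2 * (Re w)\<^sup>2 \<le> P (Re w)" using strongly_convex[of 0 "Re w"] P0 h0 by simp
  have "(Im w)\<^sup>2 \<le> 2 * c" using * P m_pos by (smt (verit) divide_nonneg_pos mult_nonneg_nonneg zero_le_power2 field_sum_of_halves)
  moreover have "(Re w)\<^sup>2 \<le> 2 * c / m"
  proof -
    have "m / 2 * (Re w)\<^sup>2 \<le> c" using * P zero_le_power2[of "Im w"] by linarith
    then show ?thesis using m_pos by (simp add: field_simps)
  qed
  ultimately have "(norm w)\<^sup>2 \<le> 2 * c / m + 2 * c" by (simp add: cmod_power2)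
  then show "norm w \<le> sqrt (2 * c / m + 2 * c)" by (rule real_le_rsqrt)
qed

text \<open>
  On a connected set that avoids the level set the energy cannot cross the value \<open>c\<close>, so the component of \<open>z\<close>
  stays in the bounded sublevel set.
\<close>

lemma sublevel_inside:
  assumes "H z < c"
  shows "plane z \<in> inside {w. H (Re w, Im w) = c}"
proof -
  define S where S: "S = {w. H (Re w, Im w) = c}"
  let ?C = "connected_component_set (- S) (plane z)"
  let ?H = "\<lambda>w. H (Re w, Im w)"
  have z: "?H (plane z) = H z" by (simp add: plane_def)
  have "?C \<subseteq> {w. ?H w < c}"
  proof
    fix w assume w: "w \<in> ?C"
    have zC: "plane z \<in> ?C" using assms z by (intro connected_component_refl_eq[THEN iffD2, unfolded mem_Collect_eq] CollectI) (auto simp: S)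
    have conn: "connected (?H ` ?C)"
      by (intro connected_continuous_image continuous_on_subset[OF H_continuous]) auto
    have "c \<notin> ?H ` ?C" using connected_component_subset[of "- S" "plane z"] S by auto
    moreover have "c \<in> ?H ` ?C" if "c \<le> ?H w"
      using connectedD_interval[OF conn imageI[OF zC] imageI[OF w]] assms z that by simp
    ultimately show "w \<in> {w. ?H w < c}" by (cases "c \<le> ?H w") auto
  qed
  then have "bounded ?C" using sublevel_bounded bounded_subset by blast
  then show ?thesis using assms z unfolding inside_def S by auto
qed

text \<open>
  The angle \<open>\<theta>\<close> is the imaginary part of a continuous logarithm along \<open>\<gamma>\<close>.  It increases by \<open>2 \<pi>\<close> because
  \<open>\<gamma>\<close> winds once around the minimum, and it is injective because each ray meets the level set only once.
  So the rescaled angle \<open>r\<close> is a homeomorphism of the unit interval, and \<open>\<rho>\<close> is \<open>\<gamma>\<close> parametrized by \<open>r\<close>.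
\<close>

lemma polar_reparametrization:
  assumes \<gamma>: "simple_path \<gamma>" "pathfinish \<gamma> = pathstart \<gamma>" and img: "path_image \<gamma> = {z. H z = c}"
    and ccw: "counterclockwise \<gamma>" and c: "c > 0"
  obtains \<rho> r R where "R-lipschitz_on {0..1} \<rho>" "\<rho> 0 = \<rho> 1" "loop_free \<rho>" "\<rho> ` {0..1} = {z. H z = c}"
    "\<And>z. H z < c \<Longrightarrow> winding_number (plane \<circ> \<rho>) (plane z) = 1"
    "\<And>t. t \<in> {0..1} \<Longrightarrow> \<gamma> t = \<rho> (r t)"
    "continuous_on {0..1} r" "mono_on {0..1} r" "r 0 = 0" "r 1 = 1"
proof -
  have cc: "complex_contour \<gamma> = plane \<circ> \<gamma>" by (auto simp: complex_contour_def plane_def fun_eq_iff)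
  have \<gamma>cont: "continuous_on {0..1} \<gamma>" using \<gamma>(1) by (simp add: simple_path_def path_def)
  have plane_cont: "continuous_on S plane" for S
    by (intro lipschitz_on_continuous_on[of 1] lipschitz_onI) (auto simp: dist_norm plane_norm)
  have path: "path (plane \<circ> \<gamma>)" unfolding path_def by (intro continuous_on_compose \<gamma>cont plane_cont)
  have img': "path_image (plane \<circ> \<gamma>) = {w. H (Re w, Im w) = c}"
  proof -
    have "path_image (plane \<circ> \<gamma>) = plane ` {z. H z = c}" using img by (simp only: path_image_def image_comp[symmetric])
    also have "\<dots> = {w. H (Re w, Im w) = c}"
    proof (intro set_eqI iffI)
      fix w assume "w \<in> {w. H (Re w, Im w) = c}"
      then show "w \<in> plane ` {z. H z = c}" by (intro image_eqI[of _ _ "(Re w, Im w)"]) (auto simp: plane_def)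
    qed (auto simp: plane_def)
    finally show ?thesis .
  qed
  have wn: "winding_number (plane \<circ> \<gamma>) (plane z) = 1" if "H z < c" for z
    using ccw sublevel_inside[OF that] unfolding counterclockwise_def cc img' by blast
  have level: "H (\<gamma> t) = c" if "t \<in> {0..1}" for t using img that by (auto simp: path_image_def)
  have pl0: "plane 0 = 0" by (simp add: plane_def complex_eq_iff)
  have "0 \<notin> path_image (plane \<circ> \<gamma>)" using img' H_0 c by (simp add: zero_prod_def)
  then obtain g where g: "path g" "pathfinish g - pathstart g = 2 * of_real pi * \<i> * winding_number (plane \<circ> \<gamma>) 0"
    "\<And>t. t \<in> {0..1} \<Longrightarrow> (plane \<circ> \<gamma>) t = 0 + exp (g t)"
    using winding_number_as_continuous_log[OF path] by blast
  define \<theta> where "\<theta> t = Im (g t)" for t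
  define q where "q t = exp (Re (g t))" for t
  define r where "r t = (\<theta> t - \<theta> 0) / (2 * pi)" for t
  have \<gamma>polar: "\<gamma> t = q t *\<^sub>R (cos (\<theta> t), sin (\<theta> t))" if "t \<in> {0..1}" for t
  proof -
    have "plane (\<gamma> t) = exp (g t)" using g(3)[OF that] by simp
    then show ?thesis
      by (simp add: plane_def complex_eq_iff q_def \<theta>_def Re_exp Im_exp prod_eq_iff)
  qed
  have "g 1 - g 0 = 2 * of_real pi * \<i>"
    using g(2) wn[of 0] H_0 c pl0 by (simp add: pathfinish_def pathstart_def)
  then have "\<theta> 1 - \<theta> 0 = 2 * pi" unfolding \<theta>_def by (simp flip: minus_complex.simps(2))
  then have r01: "r 0 = 0" "r 1 = 1" by (simp_all add: r_def)
  have rcont: "continuous_on {0..1} r"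
    using g(1) unfolding r_def \<theta>_def path_def by (auto intro!: continuous_intros)
  have "compact (\<gamma> ` {0..1})" using \<gamma>cont by (intro compact_continuous_image) auto
  then obtain B where B: "\<And>t. t \<in> {0..1} \<Longrightarrow> norm (\<gamma> t) \<le> B"
    using compact_imp_bounded bounded_iff by (metis imageI)
  define K where "K = 2 * B ^ 3 / c + B"
  define R where "R = K * (4 * pi)"
  have B0: "B \<ge> 0" using B[of 0] norm_ge_zero[of "\<gamma> 0"] by (simp add: order_trans[OF norm_ge_zero])
  then have K: "K \<ge> 0" unfolding K_def using c by simp
  then have R: "R \<ge> 0" by (simp add: R_def)
  \<comment> \<open>This estimate gives both the Lipschitz bound for \<open>\<rho>\<close> and the injectivity of \<open>r\<close>.\<close>
  have lip: "norm (\<gamma> s - \<gamma> t) \<le> R * \<bar>r s - r t\<bar>" if st: "s \<in> {0..1}" "t \<in> {0..1}" for s t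
  proof -
    let ?e = "\<lambda>t. (cos (\<theta> t), sin (\<theta> t)) :: real \<times> real"
    have e: "norm (?e t) = 1" for t by (simp add: norm_Pair)
    have q: "0 < q t" for t by (simp add: q_def)
    have qB: "q t \<le> B" if "t \<in> {0..1}" for t
      using B[OF that] q[of t] e[of t] unfolding \<gamma>polar[OF that] norm_scaleR by simp
    have "norm (\<gamma> s - \<gamma> t) \<le> K * norm (?e s - ?e t)"
      unfolding K_def \<gamma>polar[OF st(1)] \<gamma>polar[OF st(2)]
      using level[OF st(1)] level[OF st(2)] \<gamma>polar[OF st(1)] \<gamma>polar[OF st(2)] e q qB st c
      by (intro level_set_polar_lipschitz) auto
    also have "\<dots> \<le> K * (2 * \<bar>\<theta> s - \<theta> t\<bar>)"
      by (rule mult_left_mono[OF norm_unit_vector_diff K])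
    also have "\<bar>\<theta> s - \<theta> t\<bar> = 2 * pi * \<bar>r s - r t\<bar>"
    proof -
      have "r s - r t = (\<theta> s - \<theta> t) / (2 * pi)" by (simp add: r_def diff_divide_distrib)
      then show ?thesis by (simp add: abs_divide)
    qed
    finally show ?thesis by (simp add: R_def mult_ac)
  qed
  have \<gamma>inj: "s = t \<or> (s = 0 \<and> t = 1) \<or> (s = 1 \<and> t = 0)"
    if "s \<in> {0..1}" "t \<in> {0..1}" "\<gamma> s = \<gamma> t" for s t
    using \<gamma>(1) that unfolding simple_path_def loop_free_def by blast
  have rinj: "inj_on r {0..1}"
  proof (rule inj_onI)
    fix s t :: real assume st: "s \<in> {0..1}" "t \<in> {0..1}" "r s = r t"
    then have "\<gamma> s = \<gamma> t" using lip[of s t] by simp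
    then show "s = t" using \<gamma>inj[OF st(1,2)] st(3) r01 by auto
  qed
  then have "strict_mono_on {0..1} r \<or> strict_antimono_on {0..1} r"
    using injective_eq_monotone_map[OF _ rcont] by (simp add: is_interval_cc)
  moreover have "\<not> strict_antimono_on {0..1} r"
  proof
    assume "strict_antimono_on {0..1} r"
    from monotone_onD[OF this, of 0 1] show False using r01 by simp
  qed
  ultimately have rmono: "mono_on {0..1} r" by (auto intro: strict_mono_on_imp_mono_on)
  have rimg: "r ` {0..1} = {0..1}"
  proof
    show "r ` {0..1} \<subseteq> {0..1}"
      using mono_onD[OF rmono, of 0] mono_onD[OF rmono, of _ 1] r01 by auto
    show "{0..1} \<subseteq> r ` {0..1}"
    proof
      fix y :: real assume "y \<in> {0..1}"
      then show "y \<in> r ` {0..1}" using IVT'[of r 0 y 1] r01 rcont by auto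
    qed
  qed
  define i where "i = inv_into {0..1} r"
  have i: "i x \<in> {0..1}" "r (i x) = x" if "x \<in> {0..1}" for x
    using inv_into_into[of x r "{0..1}"] f_inv_into_f[of x r "{0..1}"] that unfolding rimg i_def by auto
  have ir: "i (r t) = t" if "t \<in> {0..1}" for t using inv_into_f_f[OF rinj that] by (simp add: i_def)
  define \<rho> where "\<rho> x = \<gamma> (i x)" for x
  have \<rho>r: "\<gamma> t = \<rho> (r t)" if "t \<in> {0..1}" for t using ir[OF that] by (simp add: \<rho>_def)
  have \<rho>lip: "R-lipschitz_on {0..1} \<rho>"
  proof (rule lipschitz_onI[OF _ R])
    fix x y :: real assume "x \<in> {0..1}" "y \<in> {0..1}"
    then show "dist (\<rho> x) (\<rho> y) \<le> R * dist x y"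
      using lip[of "i x" "i y"] i by (simp add: \<rho>_def dist_norm)
  qed
  have \<rho>01: "\<rho> 0 = \<rho> 1"
    using \<gamma>(2) \<rho>r[of 0] \<rho>r[of 1] r01 by (simp add: pathfinish_def pathstart_def)
  have \<rho>path: "path (plane \<circ> \<rho>)"
    unfolding path_def by (intro continuous_on_compose lipschitz_on_continuous_on[OF \<rho>lip] plane_cont)
  have \<rho>img: "\<rho> ` {0..1} = {z. H z = c}"
  proof -
    have "i ` {0..1} = {0..1}"
      using i ir rimg by (metis (no_types, lifting) image_cong image_ident image_image)
    then have "\<rho> ` {0..1} = \<gamma> ` {0..1}" unfolding \<rho>_def by (metis image_image)
    then show ?thesis using img by (simp add: path_image_def)
  qed
  show ?thesis
  proof (rule that[OF \<rho>lip \<rho>01 _ \<rho>img _ \<rho>r rcont rmono r01])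
    show "loop_free \<rho>"
      unfolding loop_free_def
    proof (intro ballI impI)
      fix x y :: real assume xy: "x \<in> {0..1}" "y \<in> {0..1}" "\<rho> x = \<rho> y"
      have "i 0 = 0" "i 1 = 1" using ir[of 0] ir[of 1] r01 by auto
      have "i x = i y \<or> i x = 0 \<and> i y = 1 \<or> i x = 1 \<and> i y = 0"
        using \<gamma>inj[OF i(1)[OF xy(1)] i(1)[OF xy(2)]] xy(3) by (auto simp: \<rho>_def)
      then show "x = y \<or> x = 0 \<and> y = 1 \<or> x = 1 \<and> y = 0"
        using i(2)[OF xy(1)] i(2)[OF xy(2)] r01 by metis
    qed
    fix z assume z: "H z < c"
    have "homotopic_paths (- {plane z}) (plane \<circ> \<rho>) (plane \<circ> \<gamma>)"
    proof (rule homotopic_paths_reparametrize[OF \<rho>path _ rcont _ r01])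
      show "path_image (plane \<circ> \<rho>) \<subseteq> - {plane z}"
        using \<rho>img z by (auto simp: path_image_def plane_def prod_eq_iff)
      show "r \<in> {0..1} \<rightarrow> {0..1}" using rimg by auto
      show "(plane \<circ> \<gamma>) t = (plane \<circ> \<rho>) (r t)" if "t \<in> {0..1}" for t using \<rho>r[OF that] by simp
    qed
    then show "winding_number (plane \<circ> \<rho>) (plane z) = 1"
      using winding_number_homotopic_paths wn[OF z] by metis
  qed
qed

end

section \<open>The flow\<close>

lemma nondecreasing_of_deriv_nonneg:
  fixes g g' :: "real \<Rightarrow> real"
  assumes g: "\<And>t. 0 \<le> t \<Longrightarrow> t \<le> T \<Longrightarrow> (g has_real_derivative g' t) (at t within {0..})"
    and pos: "\<And>t. 0 \<le> t \<Longrightarrow> t \<le> T \<Longrightarrow> g' t \<ge> 0" and T: "0 \<le> T"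
  shows "g 0 \<le> g T"
proof (cases "T = 0")
  case False
  then have "0 < T" using T by simp
  then obtain x where "x \<in> {0<..<T}" "g T - g 0 = g' x * (T - 0)"
    using mvt_simple[of 0 T g "\<lambda>t. (*) (g' t)"] has_field_derivative_subset[OF g, of _ "{0..T}"]
    unfolding has_field_derivative_def by fastforce
  with pos[of x] show ?thesis by (smt (verit) greaterThanLessThan_iff mult_nonneg_nonneg)
qed simp

locale damped_flow = damped_oscillator +
  fixes \<phi> :: "real \<Rightarrow> real \<times> real \<Rightarrow> real \<times> real"
  assumes flow: "forward_flow field \<phi>"
begin

lemma flow_0 [simp]: "\<phi> 0 z = z"
  using flow unfolding forward_flow_def by blast

lemma flow_deriv: "0 \<le> t \<Longrightarrow> ((\<lambda>t. \<phi> t z) has_vector_derivative field (\<phi> t z)) (at t within {0..})"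
  using flow unfolding forward_flow_def by blast

lemma flow_fst_deriv: "0 \<le> t \<Longrightarrow> ((\<lambda>t. fst (\<phi> t z)) has_real_derivative snd (\<phi> t z)) (at t within {0..})"
  using bounded_linear.has_vector_derivative[OF bounded_linear_fst flow_deriv, of t z]
  by (simp add: field_def has_real_derivative_iff_has_vector_derivative)

lemma flow_snd_deriv: "0 \<le> t \<Longrightarrow> ((\<lambda>t. snd (\<phi> t z)) has_real_derivative force (\<phi> t z)) (at t within {0..})"
  using bounded_linear.has_vector_derivative[OF bounded_linear_snd flow_deriv, of t z]
  by (simp add: field_def has_real_derivative_iff_has_vector_derivative)

lemma flow_sqdist_deriv:
  assumes "0 \<le> t"
  shows "((\<lambda>t. (norm (\<phi> t z - \<phi> t z'))\<^sup>2) has_real_derivative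
      2 * ((\<phi> t z - \<phi> t z') \<bullet> (field (\<phi> t z) - field (\<phi> t z')))) (at t within {0..})"
proof -
  have "((\<lambda>t. (fst (\<phi> t z) - fst (\<phi> t z'))\<^sup>2 + (snd (\<phi> t z) - snd (\<phi> t z'))\<^sup>2) has_real_derivative
      2 * ((\<phi> t z - \<phi> t z') \<bullet> (field (\<phi> t z) - field (\<phi> t z')))) (at t within {0..})"
    by (rule derivative_eq_intros flow_fst_deriv flow_snd_deriv assms refl)+
       (simp add: inner_prod_def field_def algebra_simps)
  then show ?thesis by (simp add: norm_prod_def)
qed

text \<open>
  Gronwall's inequality for the squared distance.  The lower bound expresses backward uniqueness and makes
  the transported curve simple.
\<close>

lemma flow_expansion:
  assumes T: "0 \<le> T"
  shows "norm (\<phi> T z - \<phi> T z') \<le> exp (rate * T) * norm (z - z')"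
    and "exp (- rate * T) * norm (z - z') \<le> norm (\<phi> T z - \<phi> T z')"
proof -
  let ?N = "\<lambda>t. (norm (\<phi> t z - \<phi> t z'))\<^sup>2"
  let ?D = "\<lambda>t. (\<phi> t z - \<phi> t z') \<bullet> (field (\<phi> t z) - field (\<phi> t z'))"
  have D: "\<bar>?D t\<bar> \<le> rate * ?N t" for t by (rule field_growth)
  have exp2: "exp (2 * x) = (exp x)\<^sup>2" for x :: real by (simp add: exp_double)
  have "?N 0 * exp (2 * rate * 0) \<le> ?N T * exp (2 * rate * T)"
  proof (rule nondecreasing_of_deriv_nonneg[OF _ _ T])
    fix t :: real assume t: "0 \<le> t"
    show "((\<lambda>t. ?N t * exp (2 * rate * t)) has_real_derivative
        (2 * ?D t + 2 * rate * ?N t) * exp (2 * rate * t)) (at t within {0..})"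
      by (rule derivative_eq_intros flow_sqdist_deriv t refl)+ (simp add: algebra_simps)
    show "0 \<le> (2 * ?D t + 2 * rate * ?N t) * exp (2 * rate * t)" using D[of t] by simp
  qed
  then have "(norm (z - z'))\<^sup>2 \<le> (norm (\<phi> T z - \<phi> T z') * exp (rate * T))\<^sup>2"
    by (simp add: power_mult_distrib exp2 mult.assoc)
  then have "norm (z - z') \<le> norm (\<phi> T z - \<phi> T z') * exp (rate * T)"
    by (rule power2_le_imp_le) simp
  then show "exp (- rate * T) * norm (z - z') \<le> norm (\<phi> T z - \<phi> T z')"
    by (simp add: exp_minus field_simps)
  have "- (?N 0 * exp (- 2 * rate * 0)) \<le> - (?N T * exp (- 2 * rate * T))"
  proof (rule nondecreasing_of_deriv_nonneg[OF _ _ T])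
    fix t :: real assume t: "0 \<le> t"
    show "((\<lambda>t. - (?N t * exp (- 2 * rate * t))) has_real_derivative
        (2 * rate * ?N t - 2 * ?D t) * exp (- 2 * rate * t)) (at t within {0..})"
      by (rule derivative_eq_intros flow_sqdist_deriv t refl)+ (simp add: algebra_simps)
    show "0 \<le> (2 * rate * ?N t - 2 * ?D t) * exp (- 2 * rate * t)" using D[of t] by simp
  qed
  then have "(norm (\<phi> T z - \<phi> T z') * exp (- rate * T))\<^sup>2 \<le> (norm (z - z'))\<^sup>2"
    using exp2[of "- rate * T"] by (simp add: power_mult_distrib mult.assoc)
  then have "norm (\<phi> T z - \<phi> T z') * exp (- rate * T) \<le> norm (z - z')"
    by (rule power2_le_imp_le) simp
  then show "norm (\<phi> T z - \<phi> T z') \<le> exp (rate * T) * norm (z - z')"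
    by (simp add: exp_minus field_simps)
qed

lemma flow_inj:
  assumes "0 \<le> T" "\<phi> T z = \<phi> T z'"
  shows "z = z'"
  using flow_expansion(2)[OF assms(1), of z z'] assms(2) by (simp add: mult_le_0_iff not_le[symmetric])

lemma flow_continuous: "continuous_on ({0..} \<times> UNIV) (\<lambda>(t, z). \<phi> t z)"
proof (rule continuous_on_TimesI)
  show "continuous_on {0..} (\<lambda>t. \<phi> t z)" for z
    unfolding continuous_on_eq_continuous_within
    by (intro ballI has_vector_derivative_continuous[OF flow_deriv]) simp
  show "local_lipschitz {0..} UNIV (\<lambda>t z. \<phi> t z)"
  proof (rule local_lipschitzI)
    fix t :: real and x :: "real \<times> real"
    assume t: "t \<in> {0..}"
    have "(exp (rate * (t + 1)))-lipschitz_on (cball x 1 \<inter> UNIV) (\<phi> s)" if "s \<in> cball t 1 \<inter> {0..}" for s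
    proof (rule lipschitz_onI)
      fix z z' :: "real \<times> real"
      have "rate * s \<le> rate * (t + 1)"
        using that rate_pos by (intro mult_left_mono) (auto simp: dist_real_def)
      then have "exp (rate * s) * norm (z - z') \<le> exp (rate * (t + 1)) * norm (z - z')"
        by (intro mult_right_mono) auto
      with flow_expansion(1)[of s z z'] that show "dist (\<phi> s z) (\<phi> s z') \<le> exp (rate * (t + 1)) * dist z z'"
        by (simp add: dist_norm)
    qed simp
    then show "\<exists>u>0. \<exists>L. \<forall>t\<in>cball t u \<inter> {0..}. L-lipschitz_on (cball x u \<inter> UNIV) (\<phi> t)"
      by (intro exI[of _ 1] conjI exI[of _ "exp (rate * (t + 1))"] ballI) simp_all
  qed
qed

text \<open>
  The power of the non-potential force is \<open>- 2 d p\<^sup>2 - p (h (q + \<beta> p) - h q)\<close>, and both terms are nonpositive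
  because \<open>h\<close> is increasing and \<open>\<beta> \<ge> 0\<close>.
\<close>

lemma energy_decreasing:
  assumes T: "0 \<le> T"
  shows "H (\<phi> T z) \<le> H z"
proof -
  have "- H (\<phi> 0 z) \<le> - H (\<phi> T z)"
  proof (rule nondecreasing_of_deriv_nonneg[OF _ _ T])
    fix t :: real assume t: "0 \<le> t"
    let ?q = "fst (\<phi> t z)" and ?p = "snd (\<phi> t z)"
    have DP: "((\<lambda>t. P (fst (\<phi> t z))) has_real_derivative h ?q * ?p) (at t within {0..})"
      by (rule DERIV_chain2[OF P_deriv flow_fst_deriv[OF t]])
    have "((\<lambda>t. (snd (\<phi> t z))\<^sup>2 / 2) has_real_derivative ?p * force (\<phi> t z)) (at t within {0..})"
      by (rule DERIV_cong[OF DERIV_cdivide[OF DERIV_power[OF flow_snd_deriv[OF t], where n=2], where c=2]]) simp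
    from DERIV_minus[OF DERIV_add[OF this DP]]
    show "((\<lambda>t. - H (\<phi> t z)) has_real_derivative
        2 * d * ?p\<^sup>2 + ?p * (h (?q + \<beta> * ?p) - h ?q)) (at t within {0..})"
      unfolding H_def by (rule DERIV_cong) (simp add: force_def power2_eq_square algebra_simps)
    have "0 \<le> ?p * (h (?q + \<beta> * ?p) - h ?q)"
    proof (cases "\<beta> = 0")
      case False
      have "0 \<le> m * (\<beta> * ?p)\<^sup>2" using m_pos by simp
      also have "\<dots> \<le> \<beta> * (?p * (h (?q + \<beta> * ?p) - h ?q))"
        using h_strongly_mono[of "?q + \<beta> * ?p" ?q] by (simp add: algebra_simps)
      finally show ?thesis using False \<beta>_nonneg by (simp add: zero_le_mult_iff)
    qed simp
    then show "0 \<le> 2 * d * ?p\<^sup>2 + ?p * (h (?q + \<beta> * ?p) - h ?q)" using d_pos by simp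
  qed
  then show ?thesis by simp
qed

end

section \<open>Areas along the transported level set\<close>

locale transported_level_set = damped_flow +
  fixes \<rho> :: "real \<Rightarrow> real \<times> real" and c R :: real
  assumes \<rho>_lipschitz: "R-lipschitz_on {0..1} \<rho>"
    and \<rho>_loop: "\<rho> 0 = \<rho> 1" and \<rho>_free: "loop_free \<rho>"
    and \<rho>_image: "\<rho> ` {0..1} = {z. H z = c}" and c_pos: "c > 0"
    and winding_inside: "H z < c \<Longrightarrow> winding_number (plane \<circ> \<rho>) (plane z) = 1"
begin

lemma \<rho>_level: "x \<in> {0..1} \<Longrightarrow> H (\<rho> x) = c"
  using \<rho>_image by blast

lemma orbit_lipschitz:
  assumes T: "0 \<le> T" and g: "\<And>z z'. norm (g z - g z') \<le> k * norm (z - z')" and k: "0 \<le> k"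
  shows "(k * (exp (rate * T) * R))-lipschitz_on {0..1} (\<lambda>x. g (\<phi> T (\<rho> x)))"
proof (rule lipschitz_onI)
  show "0 \<le> k * (exp (rate * T) * R)" using k lipschitz_on_nonneg[OF \<rho>_lipschitz] by simp
  fix x y :: real assume xy: "x \<in> {0..1}" "y \<in> {0..1}"
  have "dist (g (\<phi> T (\<rho> x))) (g (\<phi> T (\<rho> y))) \<le> k * norm (\<phi> T (\<rho> x) - \<phi> T (\<rho> y))"
    using g by (simp add: dist_norm)
  also have "\<dots> \<le> k * (exp (rate * T) * norm (\<rho> x - \<rho> y))"
    using k flow_expansion(1)[OF T] by (intro mult_left_mono) auto
  also have "\<dots> \<le> k * (exp (rate * T) * (R * dist x y))"
    using k lipschitz_onD[OF \<rho>_lipschitz xy] by (intro mult_left_mono) (auto simp: dist_norm)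
  finally show "dist (g (\<phi> T (\<rho> x))) (g (\<phi> T (\<rho> y))) \<le> k * (exp (rate * T) * R) * dist x y"
    by (simp add: mult.assoc)
qed

definition orbit_q :: "real \<Rightarrow> real \<Rightarrow> real" where "orbit_q t x = fst (\<phi> t (\<rho> x))"
definition orbit_p :: "real \<Rightarrow> real \<Rightarrow> real" where "orbit_p t x = snd (\<phi> t (\<rho> x))"
text \<open>
  The slope is that of \<open>P\<close> at the look-ahead point \<open>q + \<beta> p\<close>, not at the position \<open>q\<close>.
\<close>

definition orbit_slope :: "real \<Rightarrow> real \<Rightarrow> real" where "orbit_slope t x = h (orbit_q t x + \<beta> * orbit_p t x)"
definition orbit_force :: "real \<Rightarrow> real \<Rightarrow> real" where "orbit_force t x = force (\<phi> t (\<rho> x))"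
definition area :: "real \<Rightarrow> real" where "area t = line_integral (orbit_q t) (orbit_p t)"
definition sheared_area :: "real \<Rightarrow> real" where "sheared_area t = line_integral (orbit_slope t) (orbit_p t)"

lemma fst_snd_lipschitz: "norm (fst z - fst z') \<le> 1 * norm (z - z')" "norm (snd z - snd z') \<le> 1 * norm (z - z')"
  for z z' :: "real \<times> real"
  using norm_fst_le[of "fst z - fst z'" "snd z - snd z'"] norm_snd_le[of "snd z - snd z'" "fst z - fst z'"]
  by (simp_all add: minus_prod_def)

lemma orbit_components_lipschitz:
  assumes "0 \<le> t"
  shows "(exp (rate * t) * R)-lipschitz_on {0..1} (orbit_q t)"
    and "(exp (rate * t) * R)-lipschitz_on {0..1} (orbit_p t)"
    and "(rate * (exp (rate * t) * R))-lipschitz_on {0..1} (orbit_force t)"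
  using orbit_lipschitz[OF assms, of fst 1] orbit_lipschitz[OF assms, of snd 1] orbit_lipschitz[OF assms, of force rate]
    fst_snd_lipschitz force_lipschitz rate_pos unfolding orbit_q_def[abs_def] orbit_p_def[abs_def] orbit_force_def[abs_def]
  by (simp_all)

lemma lipschitz_loops:
  assumes "0 \<le> t"
  shows "lipschitz_loop (orbit_q t)" "lipschitz_loop (orbit_p t)" "lipschitz_loop (orbit_slope t)" "lipschitz_loop (orbit_force t)"
proof -
  show q: "lipschitz_loop (orbit_q t)" and p: "lipschitz_loop (orbit_p t)" and "lipschitz_loop (orbit_force t)"
    unfolding lipschitz_loop_def using orbit_components_lipschitz[OF assms] \<rho>_loop
    by (auto simp: orbit_q_def orbit_p_def orbit_force_def)
  show "lipschitz_loop (orbit_slope t)"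
    unfolding orbit_slope_def[abs_def]
    by (intro lipschitz_loop_compose[where h=h] lipschitz_loop_add lipschitz_loop_cmult q p h_lipschitz)
qed

text \<open>
  With \<open>q = u - \<beta> p\<close>, the integral of \<open>q dh(u)\<close> splits into that of \<open>u dh(u)\<close>, which vanishes because
  \<open>h u du\<close> is exact, and \<open>- \<beta>\<close> times that of \<open>p dh(u)\<close>, which is minus the sheared area.
\<close>

lemma line_integral_force:
  assumes t: "0 \<le> t"
  shows "line_integral (orbit_q t) (orbit_force t) = - (2 * d * area t + \<beta> * sheared_area t)"
proof -
  note [simp] = lipschitz_loops[OF t]
  define u where "u x = orbit_q t x + \<beta> * orbit_p t x" for x
  have u: "lipschitz_loop u" unfolding u_def[abs_def] by (intro lipschitz_loop_add lipschitz_loop_cmult) simp_all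
  have q: "orbit_q t = (\<lambda>x. u x + (- \<beta>) * orbit_p t x)" by (simp add: u_def fun_eq_iff)
  have f: "orbit_force t = (\<lambda>x. - 2 * d * orbit_p t x + (- 1) * orbit_slope t x)"
    by (simp add: fun_eq_iff orbit_force_def force_def orbit_slope_def orbit_q_def orbit_p_def)
  have "line_integral u (orbit_slope t) = - line_integral (orbit_slope t) u" by (rule line_integral_swap) (simp_all add: u)
  also have "line_integral (orbit_slope t) u = 0"
    using line_integral_exact[OF u, of P h] P_taylor by (simp add: orbit_slope_def[abs_def] u_def)
  finally have "line_integral (orbit_q t) (orbit_slope t) = \<beta> * sheared_area t"
    unfolding q line_integral_add_scaled_left[OF u lipschitz_loops(2,3)[OF t]] sheared_area_def
    using line_integral_swap[of "orbit_slope t" "orbit_p t"] by simp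
  moreover have "line_integral (orbit_q t) (orbit_force t) = line_integral (orbit_q t) (\<lambda>x. - 2 * d * orbit_p t x) + (- 1) * line_integral (orbit_q t) (orbit_slope t)"
    unfolding f by (rule line_integral_add_scaled_right[OF lipschitz_loops(1)[OF t]
        lipschitz_loop_cmult[OF lipschitz_loops(2)[OF t]] lipschitz_loops(3)[OF t]])
  moreover have "line_integral (orbit_q t) (\<lambda>x. - 2 * d * orbit_p t x) = - 2 * d * area t"
    using line_integral_add_scaled_right[of "orbit_q t" "orbit_p t" "orbit_p t" "- 2 * d - 1"] by (simp add: area_def algebra_simps)
  ultimately show ?thesis by simp
qed

text \<open>
  The area solves \<open>A' = - (2 d A + \<beta> B)\<close>, so with \<open>B(t) \<le> B(0)\<close> the function \<open>(A + b) exp (2 d t)\<close> does not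
  decrease.  The argument is carried out for Riemann sums, which are differentiable in time term by term;
  shifting \<open>b\<close> by \<open>C / (2 d n)\<close> absorbs the discretization errors, and \<open>n\<close> tends to infinity at the end.
\<close>

lemma area_lower_bound:
  assumes T: "0 \<le> T" and B: "\<And>t. 0 \<le> t \<Longrightarrow> t \<le> T \<Longrightarrow> sheared_area t \<le> sheared_area 0"
  defines "b \<equiv> \<beta> * sheared_area 0 / (2 * d)"
  shows "area 0 + b \<le> (area T + b) * exp (2 * d * T)"
proof -
  define K where "K = exp (rate * T) * R"
  \<comment> \<open>The errors of the sums for \<open>p dp\<close>, for \<open>q\<close> against the force, and for the area in the damping term.\<close>
  define C where "C = 3 * K * K + 3 * K * (rate * K) + 2 * d * (3 * K * K)"
  have R: "R \<ge> 0" by (rule lipschitz_on_nonneg[OF \<rho>_lipschitz])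
  have bound: "riemann_sum (orbit_q 0) (orbit_p 0) n + (b + C / (2 * d) / n)
      \<le> (riemann_sum (orbit_q T) (orbit_p T) n + (b + C / (2 * d) / n)) * exp (2 * d * T)" if n: "n > 0" for n
  proof -
    define b' where "b' = b + C / (2 * d) / n"
    define g where "g t = riemann_sum (orbit_q t) (orbit_p t) n" for t
    define g' where "g' t = riemann_sum (orbit_p t) (orbit_p t) n + riemann_sum (orbit_q t) (orbit_force t) n" for t
    have "(g 0 + b') * exp (2 * d * 0) \<le> (g T + b') * exp (2 * d * T)"
    proof (rule nondecreasing_of_deriv_nonneg[OF _ _ T])
      fix t assume t: "0 \<le> t" "t \<le> T"
      have dq: "((\<lambda>t. orbit_q t x) has_real_derivative orbit_p t x) (at t within {0..})"
        and dp: "((\<lambda>t. orbit_p t x) has_real_derivative orbit_force t x) (at t within {0..})" for x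
        unfolding orbit_q_def orbit_p_def orbit_force_def by (rule flow_fst_deriv[OF t(1)] flow_snd_deriv[OF t(1)])+
      have "((\<lambda>t. riemann_sum (orbit_q t) (orbit_p t) n) has_real_derivative
         (\<Sum>i<n. orbit_p t (i / n) * (orbit_p t (Suc i / n) - orbit_p t (i / n)) + (orbit_force t (Suc i / n) - orbit_force t (i / n)) * orbit_q t (i / n)))
         (at t within {0..})"
        unfolding riemann_sum_def by (intro DERIV_sum DERIV_mult DERIV_diff dq dp)
      also have "(\<Sum>i<n. orbit_p t (i / n) * (orbit_p t (Suc i / n) - orbit_p t (i / n)) + (orbit_force t (Suc i / n) - orbit_force t (i / n)) * orbit_q t (i / n)) = g' t"
        unfolding g'_def riemann_sum_def sum.distrib[symmetric] by (intro sum.cong refl) (simp only: mult.commute)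
      finally have dg: "(g has_real_derivative g' t) (at t within {0..})" unfolding g_def[abs_def] .
      show "((\<lambda>t. (g t + b') * exp (2 * d * t)) has_real_derivative
          (g' t + 2 * d * (g t + b')) * exp (2 * d * t)) (at t within {0..})"
        by (rule dg derivative_eq_intros refl)+ (simp add: algebra_simps)
      have "exp (rate * t) * R \<le> K" unfolding K_def
        using t rate_pos R by (intro mult_right_mono) auto
      then have lip: "K-lipschitz_on {0..1} (orbit_q t)" "K-lipschitz_on {0..1} (orbit_p t)" "(rate * K)-lipschitz_on {0..1} (orbit_force t)"
        using orbit_components_lipschitz[OF t(1)] rate_pos by (auto elim!: lipschitz_on_mono)
      have "\<bar>g t - area t\<bar> \<le> 3 * K * K / n"
        unfolding g_def area_def by (rule riemann_sum_error[OF lip(1,2) n])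
      moreover have "\<bar>riemann_sum (orbit_p t) (orbit_p t) n\<bar> \<le> 3 * K * K / n"
        using riemann_sum_error[OF lip(2,2) n] line_integral_self[OF lipschitz_loops(2)[OF t(1)]] by simp
      moreover have "\<bar>riemann_sum (orbit_q t) (orbit_force t) n + (2 * d * area t + \<beta> * sheared_area t)\<bar> \<le> 3 * K * (rate * K) / n"
        using riemann_sum_error[OF lip(1,3) n] line_integral_force[OF t(1)] by simp
      moreover have "\<beta> * sheared_area t \<le> \<beta> * sheared_area 0" using B[OF t] \<beta>_nonneg by (rule mult_left_mono)
      moreover have "2 * d * b' = \<beta> * sheared_area 0 + C / n"
        using d_pos by (simp add: b'_def b_def distrib_left)
      moreover have "C / n = 3 * K * K / n + 3 * K * (rate * K) / n + 2 * d * (3 * K * K / n)"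
        by (simp add: C_def add_divide_distrib)
      moreover have "2 * d * (area t - g t) \<le> 2 * d * (3 * K * K / n)"
        using d_pos \<open>\<bar>g t - area t\<bar> \<le> 3 * K * K / n\<close> by (intro mult_left_mono) auto
      ultimately have "0 \<le> g' t + 2 * d * (g t + b')"
        unfolding g'_def distrib_left right_diff_distrib by linarith
      then show "0 \<le> (g' t + 2 * d * (g t + b')) * exp (2 * d * t)" by simp
    qed
    then show ?thesis by (simp add: g_def b'_def)
  qed
  have lim: "(\<lambda>n. riemann_sum (orbit_q t) (orbit_p t) n + (b + C / (2 * d) / n)) \<longlonglongrightarrow> area t + (b + 0)" if "0 \<le> t" for t
    unfolding area_def
    by (intro tendsto_add tendsto_const riemann_sum_tendsto_loop lipschitz_loops that lim_const_over_n)
  have "area 0 + (b + 0) \<le> (area T + (b + 0)) * exp (2 * d * T)"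
  proof (rule tendsto_le[OF _ tendsto_mult_right[OF lim[OF T]] lim[of 0]])
    show "\<forall>\<^sub>F n in sequentially. riemann_sum (orbit_q 0) (orbit_p 0) n + (b + C / (2 * d) / n)
      \<le> (riemann_sum (orbit_q T) (orbit_p T) n + (b + C / (2 * d) / n)) * exp (2 * d * T)"
      using eventually_gt_at_top[of 0] by eventually_elim (rule bound)
  qed auto
  then show ?thesis by simp
qed


lemma shear_orbit_lipschitz:
  assumes T: "0 \<le> T"
  obtains M where "M-lipschitz_on {0..1} (\<lambda>x. shear (\<phi> T (\<rho> x)))"
  using orbit_lipschitz[OF T, of shear "2 + \<beta>"] shear_lipschitz \<beta>_nonneg by auto

lemma plane_loop_lipschitz: "R-lipschitz_on {0..1} (plane \<circ> \<rho>)"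
  using \<rho>_lipschitz unfolding lipschitz_on_def dist_norm o_def plane_norm .

lemma winding_outside:
  assumes "c < H z"
  shows "winding_number (plane \<circ> \<rho>) (plane z) = 0"
proof (rule winding_number_zero_outside[where s="{w. H (Re w, Im w) \<le> c}"])
  show "path (plane \<circ> \<rho>)"
    unfolding path_def by (rule lipschitz_on_continuous_on[OF plane_loop_lipschitz])
  show "path_image (plane \<circ> \<rho>) \<subseteq> {w. H (Re w, Im w) \<le> c}"
    using \<rho>_level by (auto simp: path_image_def plane_def)
qed (use assms in \<open>auto simp: convex_sublevel pathfinish_def pathstart_def \<rho>_loop plane_def\<close>)

text \<open>
  The straight-line homotopy from the identity to the shear keeps \<open>p\<close> and moves \<open>q\<close> monotonically, so it
  stays injective and no point of the curve ever hits the image of \<open>z\<close>.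
\<close>

lemma winding_shear:
  assumes z: "H z \<noteq> c"
  shows "winding_number (\<lambda>x. shear (\<rho> x)) (shear z) = winding_number (plane \<circ> \<rho>) (plane z)"
proof -
  obtain M where "M-lipschitz_on {0..1} (\<lambda>x. shear (\<phi> 0 (\<rho> x)))" by (rule shear_orbit_lipschitz[of 0]) auto
  then have "continuous_on {0..1} (\<lambda>x. shear (\<rho> x))" by (simp add: lipschitz_on_continuous_on)
  moreover have "continuous_on {0..1} (\<lambda>x. plane (\<rho> x))"
    using lipschitz_on_continuous_on[OF plane_loop_lipschitz] by (simp add: o_def)
  ultimately have "winding_number (\<lambda>x. shear (\<rho> x) - shear z) 0 = winding_number (\<lambda>x. plane (\<rho> x) - plane z) 0"
  proof (intro winding_number_loops_linear_eq)
    fix x :: real assume x: "x \<in> {0..1}"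
    show "0 \<notin> closed_segment (plane (\<rho> x) - plane z) (shear (\<rho> x) - shear z)"
    proof
      assume "0 \<in> closed_segment (plane (\<rho> x) - plane z) (shear (\<rho> x) - shear z)"
      then obtain u where u: "0 \<le> u" "u \<le> 1"
        and eq: "0 = (1 - u) *\<^sub>R (plane (\<rho> x) - plane z) + u *\<^sub>R (shear (\<rho> x) - shear z)"
        by (auto simp: closed_segment_def)
      let ?a = "fst (\<rho> x) - fst z"
      have "Im ((1 - u) *\<^sub>R (plane (\<rho> x) - plane z) + u *\<^sub>R (shear (\<rho> x) - shear z)) = 0"
        unfolding eq[symmetric] by simp
      then have p: "snd (\<rho> x) = snd z" by (simp add: plane_def shear_def algebra_simps)
      define k where "k = h (fst (\<rho> x) + \<beta> * snd (\<rho> x)) - h (fst z + \<beta> * snd z)"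
      have "Re ((1 - u) *\<^sub>R (plane (\<rho> x) - plane z) + u *\<^sub>R (shear (\<rho> x) - shear z)) = 0"
        unfolding eq[symmetric] by simp
      then have q: "(1 - u) * ?a + u * k = 0" by (simp add: plane_def shear_def k_def)
      have k: "m * ?a\<^sup>2 \<le> k * ?a"
        using h_strongly_mono[of "fst (\<rho> x) + \<beta> * snd (\<rho> x)" "fst z + \<beta> * snd z"] by (simp add: p k_def)
      have "?a \<noteq> 0"
      proof
        assume "?a = 0"
        then have "\<rho> x = z" using p by (simp add: prod_eq_iff)
        then show False using \<rho>_level[OF x] z by simp
      qed
      then have a2: "?a\<^sup>2 > 0" by simp
      have "((1 - u) + u * m) * ?a\<^sup>2 = (1 - u) * ?a\<^sup>2 + u * (m * ?a\<^sup>2)" by (simp add: algebra_simps)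
      also have "\<dots> \<le> (1 - u) * ?a\<^sup>2 + u * (k * ?a)" using k u by (intro add_left_mono mult_left_mono) auto
      also have "\<dots> = ((1 - u) * ?a + u * k) * ?a" by (simp add: power2_eq_square algebra_simps)
      also have "\<dots> = 0" using q by simp
      finally have "(1 - u) + u * m \<le> 0" using a2 by (simp add: mult_le_0_iff)
      moreover have "(1 - u) + u * m > 0"
        using u m_pos by (cases "u = 1") (auto intro: add_pos_nonneg)
      ultimately show False by simp
    qed
  qed (auto simp: path_def pathfinish_def pathstart_def \<rho>_loop intro!: continuous_intros)
  then show ?thesis
    using winding_number_offset[of "\<lambda>x. shear (\<rho> x)" "shear z"] winding_number_offset[of "plane \<circ> \<rho>" "plane z"]
    by (simp add: o_def)
qed

text \<open>
  The homotopy is the flow itself: starting from the level \<open>c\<close>, it never reaches a higher energy.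
\<close>

lemma winding_shear_flow:
  assumes T: "0 \<le> T" and z: "c < H z"
  shows "winding_number (\<lambda>x. shear (\<phi> T (\<rho> x))) (shear z) = winding_number (\<lambda>x. shear (\<rho> x)) (shear z)"
proof -
  let ?\<Phi> = "\<lambda>(s, x). shear (\<phi> (s * T) (\<rho> x))"
  have shear_cont: "continuous_on UNIV shear"
    using \<beta>_nonneg shear_lipschitz
    by (intro lipschitz_on_continuous_on[of "2 + \<beta>"] lipschitz_onI) (auto simp: dist_norm)
  have \<rho>_cont: "continuous_on ({0..1} \<times> {0..1}) (\<lambda>y. \<rho> (snd y))"
    by (rule continuous_on_compose2[OF lipschitz_on_continuous_on[OF \<rho>_lipschitz]]) (auto intro!: continuous_intros)
  have "continuous_on ({0..1} \<times> {0..1}) (\<lambda>y. (\<lambda>(t, z). \<phi> t z) (fst y * T, \<rho> (snd y)))"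
    by (rule continuous_on_compose2[OF flow_continuous]) (use T in \<open>auto intro!: continuous_intros \<rho>_cont\<close>)
  then have "continuous_on ({0..1} \<times> {0..1}) (\<lambda>y. shear ((\<lambda>(t, z). \<phi> t z) (fst y * T, \<rho> (snd y))))"
    by (rule continuous_on_compose2[OF shear_cont]) auto
  then have cont: "continuous_on ({0..1} \<times> {0..1}) ?\<Phi>"
    by (simp add: split_def)
  have avoid: "?\<Phi> ` ({0..1} \<times> {0..1}) \<subseteq> - {shear z}"
  proof clarsimp
    fix s x :: real assume sx: "0 \<le> s" "s \<le> 1" "0 \<le> x" "x \<le> 1" and eq: "shear z = shear (\<phi> (s * T) (\<rho> x))"
    have "H (\<phi> (s * T) (\<rho> x)) \<le> c"
      using energy_decreasing[of "s * T" "\<rho> x"] sx T \<rho>_level[of x] by simp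
    then show False using shear_inj[OF eq] z by simp
  qed
  have "homotopic_loops (- {shear z}) (\<lambda>x. shear (\<rho> x)) (\<lambda>x. shear (\<phi> T (\<rho> x)))"
    unfolding homotopic_loops
    by (intro exI[of _ ?\<Phi>] conjI cont avoid[unfolded image_subset_iff_funcset]) (simp_all add: pathfinish_def pathstart_def \<rho>_loop)
  from winding_number_homotopic_loops[OF this] show ?thesis by simp
qed

lemma sheared_area_winding:
  assumes T: "0 \<le> T"
  obtains W where "integrable lborel W"
    and "AE w in lborel. w \<notin> path_image (\<lambda>x. shear (\<phi> T (\<rho> x))) \<and>
           winding_number (\<lambda>x. shear (\<phi> T (\<rho> x))) w = of_real (W w)"
    and "(\<integral>w. W w \<partial>lborel) = sheared_area T"
proof -
  obtain M where M: "M-lipschitz_on {0..1} (\<lambda>x. shear (\<phi> T (\<rho> x)))" by (rule shear_orbit_lipschitz[OF T])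
  have "Re \<circ> (\<lambda>x. shear (\<phi> T (\<rho> x))) = orbit_slope T" "Im \<circ> (\<lambda>x. shear (\<phi> T (\<rho> x))) = orbit_p T"
    by (auto simp: fun_eq_iff shear_def orbit_slope_def orbit_q_def orbit_p_def)
  moreover have "shear (\<phi> T (\<rho> 0)) = shear (\<phi> T (\<rho> 1))" using \<rho>_loop by simp
  from line_integral_eq_winding_integral[OF M this]
  obtain W where "integrable lborel W"
    and "AE w in lborel. w \<notin> path_image (\<lambda>x. shear (\<phi> T (\<rho> x))) \<and>
           winding_number (\<lambda>x. shear (\<phi> T (\<rho> x))) w = of_real (W w)"
    and "(\<integral>w. W w \<partial>lborel) = line_integral (Re \<circ> (\<lambda>x. shear (\<phi> T (\<rho> x)))) (Im \<circ> (\<lambda>x. shear (\<phi> T (\<rho> x))))"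
    by blast
  ultimately show ?thesis
    by (intro that[of W]) (simp_all only: sheared_area_def)
qed

lemma winding_shear_level:
  "H z < c \<Longrightarrow> winding_number (\<lambda>x. shear (\<rho> x)) (shear z) = 1"
  "c < H z \<Longrightarrow> winding_number (\<lambda>x. shear (\<rho> x)) (shear z) = 0"
  using winding_shear[of z] winding_inside[of z] winding_outside[of z] by auto

lemma not_on_level:
  assumes "g z \<notin> path_image (\<lambda>x. g (\<rho> x))"
  shows "H z \<noteq> c"
proof
  assume "H z = c"
  then obtain x where "x \<in> {0..1}" "z = \<rho> x" using \<rho>_image by blast
  then have "g z \<in> path_image (\<lambda>x. g (\<rho> x))" unfolding path_image_def by blast
  with assms show False by simp
qed

lemma sheared_area_nonneg: "0 \<le> sheared_area 0"
proof -
  obtain W where W: "integrable lborel W"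
    "AE w in lborel. w \<notin> path_image (\<lambda>x. shear (\<rho> x)) \<and> winding_number (\<lambda>x. shear (\<rho> x)) w = of_real (W w)"
    "(\<integral>w. W w \<partial>lborel) = sheared_area 0"
    by (rule sheared_area_winding[OF order_refl, unfolded flow_0])
  have "AE w in lborel. 0 \<le> W w"
    using W(2)
  proof eventually_elim
    case (elim w)
    obtain z where z: "w = shear z" using shear_surj[of w] by auto
    then have "H z \<noteq> c" using elim not_on_level[of shear z] by blast
    then have "complex_of_real (W w) = 1 \<or> complex_of_real (W w) = 0"
      using elim winding_shear_level[of z] z by (metis linorder_neqE)
    then show ?case by auto
  qed
  then have "0 \<le> (\<integral>w. W w \<partial>lborel)" by (rule integral_nonneg_AE)
  then show ?thesis using W(3) by simp
qed

text \<open>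
  The winding numbers are compared pointwise: the value 1 inside is the largest possible for a simple
  closed curve, and outside the winding number does not change in time.
\<close>

lemma sheared_area_le:
  assumes T: "0 \<le> T"
  shows "sheared_area T \<le> sheared_area 0"
proof -
  obtain W0 where W0: "integrable lborel W0"
    "AE w in lborel. w \<notin> path_image (\<lambda>x. shear (\<rho> x)) \<and> winding_number (\<lambda>x. shear (\<rho> x)) w = of_real (W0 w)"
    "(\<integral>w. W0 w \<partial>lborel) = sheared_area 0"
    by (rule sheared_area_winding[OF order_refl, unfolded flow_0])
  obtain W where W: "integrable lborel W"
    "AE w in lborel. w \<notin> path_image (\<lambda>x. shear (\<phi> T (\<rho> x))) \<and> winding_number (\<lambda>x. shear (\<phi> T (\<rho> x))) w = of_real (W w)"
    "(\<integral>w. W w \<partial>lborel) = sheared_area T"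
    by (rule sheared_area_winding[OF T])
  obtain M where M: "M-lipschitz_on {0..1} (\<lambda>x. shear (\<phi> T (\<rho> x)))" by (rule shear_orbit_lipschitz[OF T])
  have simple: "simple_path (\<lambda>x. shear (\<phi> T (\<rho> x)))"
    unfolding simple_path_def path_def loop_free_def
    using lipschitz_on_continuous_on[OF M] \<rho>_free flow_inj[OF T] shear_inj unfolding loop_free_def by blast
  have "AE w in lborel. W w \<le> W0 w"
    using W0(2) W(2)
  proof eventually_elim
    case (elim w)
    obtain z where z: "w = shear z" using shear_surj[of w] by auto
    then have "H z \<noteq> c" using elim not_on_level[of shear z] by blast
    then consider "H z < c" | "c < H z" by linarith
    then show ?case
    proof cases
      case 1
      then have "complex_of_real (W0 w) = 1" using elim winding_shear_level(1)[of z] z by metis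
      then have "W0 w = 1" by simp
      have "complex_of_real (W w) \<in> {-1, 0, 1}"
        using simple_closed_path_winding_number_cases[OF simple, of w] elim \<rho>_loop
        by (metis (no_types, lifting) pathfinish_def pathstart_def)
      then have "Re (complex_of_real (W w)) \<in> Re ` {-1, 0, 1}" by (rule imageI)
      then have "W w \<le> 1" by auto
      with \<open>W0 w = 1\<close> show ?thesis by simp
    next
      case 2
      then have "complex_of_real (W w) = complex_of_real (W0 w)" using winding_shear_flow[OF T 2] elim z by metis
      then show ?thesis by simp
    qed
  qed
  then have "(\<integral>w. W w \<partial>lborel) \<le> (\<integral>w. W0 w \<partial>lborel)"
    by (rule integral_mono_AE[OF W(1) W0(1)])
  then show ?thesis using W W0 by simp
qed

text \<open>
  The winding number is nonnegative almost everywhere and equal to 1 on a small disc around the minimum.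
\<close>

lemma area_pos: "0 < area 0"
proof -
  have "Re \<circ> (plane \<circ> \<rho>) = orbit_q 0" "Im \<circ> (plane \<circ> \<rho>) = orbit_p 0"
    by (auto simp: fun_eq_iff plane_def orbit_q_def orbit_p_def)
  moreover have "(plane \<circ> \<rho>) 0 = (plane \<circ> \<rho>) 1" using \<rho>_loop by simp
  ultimately obtain W where W: "integrable lborel W"
    "AE w in lborel. w \<notin> path_image (plane \<circ> \<rho>) \<and> winding_number (plane \<circ> \<rho>) w = of_real (W w)"
    "(\<integral>w. W w \<partial>lborel) = area 0"
    using line_integral_eq_winding_integral[OF plane_loop_lipschitz] unfolding area_def by (metis (no_types))
  have "open {w. H (Re w, Im w) < c}"
    using open_Collect_less[OF H_continuous continuous_on_const] by simp
  moreover have "0 \<in> {w. H (Re w, Im w) < c}" using c_pos P0 by (simp add: H_def)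
  ultimately obtain r where r: "r > 0" "ball 0 r \<subseteq> {w. H (Re w, Im w) < c}"
    by (meson openE)
  have "0 < measure lborel (ball (0::complex) r)" using r(1) by (simp add: content_ball_pos)
  also have "\<dots> = (\<integral>w. indicator (ball (0::complex) r) w \<partial>lborel)" by simp
  also have "\<dots> \<le> (\<integral>w. W w \<partial>lborel)"
  proof (rule integral_mono_AE[OF _ W(1)])
    show "integrable lborel (indicator (ball (0::complex) r) :: complex \<Rightarrow> real)"
      by (intro integrable_real_indicator emeasure_bounded_finite bounded_ball) simp
    show "AE w in lborel. indicator (ball 0 r) w \<le> W w"
      using W(2)
    proof eventually_elim
      case (elim w)
      define z where "z = (Re w, Im w)"
      have z: "w = plane z" by (simp add: z_def plane_def)
      then have "H z \<noteq> c" using elim not_on_level[of plane z] unfolding o_def by blast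
      then consider "H z < c" | "c < H z" by linarith
      then show ?case
      proof cases
        case 1
        then have "W w = 1" using elim winding_inside[of z] z by (metis of_real_eq_1_iff)
        then show ?thesis by (simp add: indicator_def)
      next
        case 2
        then have "W w = 0" using elim winding_outside[of z] z by (metis of_real_eq_0_iff)
        moreover have "w \<notin> ball 0 r" using 2 r(2) by (auto simp: z_def)
        ultimately show ?thesis by simp
      qed
    qed
  qed
  finally show ?thesis using W(3) by simp
qed

text \<open>
  The lower bound is \<open>(A(0) + b) exp (- 2 d T) - b\<close>, and the exponential lies strictly above its tangent
  \<open>1 - 2 d T\<close>.
\<close>

theorem area_contraction:
  assumes T: "0 < T"
  shows "area 0 - T * (2 * d * area 0 + \<beta> * sheared_area 0) < area T"
proof -
  define b where "b = \<beta> * sheared_area 0 / (2 * d)"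
  have db: "2 * d * b = \<beta> * sheared_area 0" using d_pos by (simp add: b_def)
  have "b \<ge> 0" unfolding b_def using \<beta>_nonneg sheared_area_nonneg d_pos by simp
  then have pos: "area 0 + b > 0" using area_pos by simp
  have "area 0 + b \<le> (area T + b) * exp (2 * d * T)"
    unfolding b_def using T by (intro area_lower_bound sheared_area_le) auto
  then have "(area 0 + b) * exp (- (2 * d * T)) \<le> area T + b"
    by (simp add: exp_minus field_simps)
  moreover have "(area 0 + b) * (1 - 2 * d * T) < (area 0 + b) * exp (- (2 * d * T))"
    using pos T d_pos by (intro mult_strict_left_mono) (simp_all add: exp_minus_greater)
  ultimately have "(area 0 + b) * (1 - 2 * d * T) < area T + b" by simp
  moreover have "(area 0 + b) * (1 - 2 * d * T) = area 0 + b - T * (2 * d * area 0 + 2 * d * b)"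
    by (simp add: algebra_simps)
  ultimately show ?thesis unfolding db by simp
qed

definition euler_step :: "real \<Rightarrow> real \<times> real \<Rightarrow> real \<times> real" where
  "euler_step T z = (let p = snd z + T * force z in (fst z + T * p, p))"

lemma signed_area_flow:
  assumes \<gamma>: "\<And>t. t \<in> {0..1} \<Longrightarrow> \<gamma> t = \<rho> (r t)"
    and r: "continuous_on {0..1} r" "mono_on {0..1} r" "r 0 = 0" "r 1 = 1" and T: "0 \<le> T"
  shows "signed_area (\<phi> T \<circ> \<gamma>) = area T"
proof -
  have eq: "fst \<circ> (\<lambda>x. \<phi> T (\<rho> x)) = orbit_q T" "snd \<circ> (\<lambda>x. \<phi> T (\<rho> x)) = orbit_p T"
    by (auto simp: fun_eq_iff orbit_q_def orbit_p_def)
  have "signed_area (\<phi> T \<circ> \<gamma>) = line_integral (fst \<circ> (\<lambda>x. \<phi> T (\<rho> x))) (snd \<circ> (\<lambda>x. \<phi> T (\<rho> x)))"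
    using orbit_components_lipschitz[OF T] \<gamma>
    by (intro signed_area_reparametrized[OF _ _ _ r]) (auto simp: eq)
  then show ?thesis by (simp only: eq area_def)
qed

text \<open>
  The update \<open>q + T p\<^sub>1\<close> of the position uses the new momentum \<open>p\<^sub>1\<close>, so it adds only the exact form \<open>p\<^sub>1 dp\<^sub>1\<close>.
  What remains is linear in the force.
\<close>

lemma signed_area_euler_step:
  assumes \<gamma>: "\<And>t. t \<in> {0..1} \<Longrightarrow> \<gamma> t = \<rho> (r t)"
    and r: "continuous_on {0..1} r" "mono_on {0..1} r" "r 0 = 0" "r 1 = 1"
  shows "signed_area (euler_step T \<circ> \<gamma>) = area 0 - T * (2 * d * area 0 + \<beta> * sheared_area 0)"
proof -
  define p1 where "p1 x = orbit_p 0 x + T * orbit_force 0 x" for x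
  note loops = lipschitz_loops[OF order_refl]
  have p1: "lipschitz_loop p1" unfolding p1_def[abs_def] by (intro lipschitz_loop_add lipschitz_loop_cmult loops)
  have q1: "lipschitz_loop (\<lambda>x. orbit_q 0 x + T * p1 x)" by (intro lipschitz_loop_add lipschitz_loop_cmult loops p1)
  have eq: "fst \<circ> (\<lambda>x. euler_step T (\<rho> x)) = (\<lambda>x. orbit_q 0 x + T * p1 x)" "snd \<circ> (\<lambda>x. euler_step T (\<rho> x)) = p1"
    by (auto simp: fun_eq_iff orbit_q_def orbit_p_def orbit_force_def p1_def euler_step_def Let_def)
  obtain M N where "M-lipschitz_on {0..1} (\<lambda>x. orbit_q 0 x + T * p1 x)" "N-lipschitz_on {0..1} p1"
    using p1 q1 unfolding lipschitz_loop_def by blast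
  then have "signed_area (euler_step T \<circ> \<gamma>) = line_integral (fst \<circ> (\<lambda>x. euler_step T (\<rho> x))) (snd \<circ> (\<lambda>x. euler_step T (\<rho> x)))"
    using \<gamma> by (intro signed_area_reparametrized[OF _ _ _ r]) (auto simp: eq)
  also have "\<dots> = line_integral (orbit_q 0) p1 + T * line_integral p1 p1"
    unfolding eq by (rule line_integral_add_scaled_left[OF loops(1) p1 p1])
  also have "line_integral p1 p1 = 0" by (rule line_integral_self[OF p1])
  also have "line_integral (orbit_q 0) p1 = area 0 + T * line_integral (orbit_q 0) (orbit_force 0)"
    unfolding p1_def[abs_def] area_def by (rule line_integral_add_scaled_right[OF loops(1,2,4)])
  also have "line_integral (orbit_q 0) (orbit_force 0) = - (2 * d * area 0 + \<beta> * sheared_area 0)"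
    by (rule line_integral_force) simp
  finally show ?thesis
    by (simp only: mult_zero_right add_0_right mult_minus_right diff_conv_add_uminus)
qed

end

section \<open>Comparison of the flow with one discrete step\<close>

theorem proposition4p2:
  fixes f :: "real \<Rightarrow> real" and L \<kappa> Ts c :: real
    and \<gamma> :: "real \<Rightarrow> real \<times> real"
    and \<phi> :: "real \<Rightarrow> real \<times> real \<Rightarrow> real \<times> real"
  assumes "\<And>x. f differentiable (at x)"
    and "L > 0" and "L-lipschitz_on UNIV (deriv f)"
    and "\<kappa> \<ge> 1"
    and "\<And>x y. f x \<ge> f y + deriv f y * (x - y) + L / (2 * \<kappa>) * \<bar>x - y\<bar>\<^sup>2"
    and "\<And>x. f 0 \<le> f x" and "f 0 = 0"
    and "Ts > 0" and "c > 0"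
    and "positively_oriented_contour {(q, p). energy f L q p = c} \<gamma>"
    and "forward_flow (dynamics f L \<kappa>) \<phi>"
  shows "signed_area \<gamma> - signed_area (discrete_step f L \<kappa> Ts \<circ> \<gamma>)
       > signed_area \<gamma> - signed_area (\<phi> Ts \<circ> \<gamma>)"
proof -
  have f_deriv: "(f has_real_derivative deriv f x) (at x)" for x
    using assms(1)[of x] DERIV_deriv_iff_real_differentiable by blast
  have sqrt: "sqrt \<kappa> \<ge> 1" "sqrt \<kappa> + 1 > 0" using assms(4) by (simp_all add: add_nonneg_pos)
  interpret damped_oscillator "\<lambda>x. f x / L" "\<lambda>x. deriv f x / L" "damping \<kappa>" "momentum \<kappa>" "1 / \<kappa>"
  proof
    show "((\<lambda>x. f x / L) has_real_derivative deriv f x / L) (at x)" for x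
      by (rule DERIV_cdivide[OF f_deriv])
    show "\<bar>deriv f x / L - deriv f y / L\<bar> \<le> \<bar>x - y\<bar>" for x y
    proof -
      have "\<bar>deriv f x - deriv f y\<bar> \<le> L * \<bar>x - y\<bar>"
        using lipschitz_onD[OF assms(3), of x y] by (simp add: dist_real_def)
      then show ?thesis using \<open>L > 0\<close> by (simp add: diff_divide_distrib[symmetric] abs_divide field_simps)
    qed
    show "f y / L + deriv f y / L * (x - y) + 1 / \<kappa> / 2 * (x - y)\<^sup>2 \<le> f x / L" for x y
    proof -
      have "(f y + deriv f y * (x - y) + L / (2 * \<kappa>) * (x - y)\<^sup>2) / L \<le> f x / L"
        using assms(5)[of y x] \<open>L > 0\<close> by (intro divide_right_mono) auto
      moreover have "(f y + deriv f y * (x - y) + L / (2 * \<kappa>) * (x - y)\<^sup>2) / L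
          = f y / L + deriv f y / L * (x - y) + 1 / \<kappa> / 2 * (x - y)\<^sup>2"
        using \<open>L > 0\<close> by (simp add: add_divide_distrib)
      ultimately show ?thesis by simp
    qed
    show "f 0 / L = 0" using assms(7) by simp
    show "deriv f 0 / L = 0"
      using DERIV_local_min[OF f_deriv[of 0], of 1] assms(6) by simp
    show "1 / \<kappa> > 0" using assms(4) by simp
    show "damping \<kappa> > 0" using sqrt by (simp add: damping_def)
    show "momentum \<kappa> \<ge> 0" using sqrt by (simp add: momentum_def)
  qed
  have H_eq: "{(q, p). energy f L q p = c} = {z. H z = c}"
    by (auto simp: energy_def H_def)
  have force_eq: "- 1 / L * deriv f q + f_NP f L \<kappa> q p = force (q, p)" for q p
    by (simp add: f_NP_def force_def right_diff_distrib)
  have dyn: "dynamics f L \<kappa> = field"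
    by (simp only: fun_eq_iff dynamics_def field_def split_paired_All prod.case force_eq fst_conv snd_conv simp_thms)
  have contour: "simple_path \<gamma>" "pathfinish \<gamma> = pathstart \<gamma>" "path_image \<gamma> = {z. H z = c}" "counterclockwise \<gamma>"
    using assms(10) unfolding positively_oriented_contour_def H_eq by auto
  obtain \<rho> r R where \<rho>: "R-lipschitz_on {0..1} \<rho>" "\<rho> 0 = \<rho> 1" "loop_free \<rho>" "\<rho> ` {0..1} = {z. H z = c}"
      "\<And>z. H z < c \<Longrightarrow> winding_number (plane \<circ> \<rho>) (plane z) = 1"
    and r: "\<And>t. t \<in> {0..1} \<Longrightarrow> \<gamma> t = \<rho> (r t)"
      "continuous_on {0..1} r" "mono_on {0..1} r" "r 0 = 0" "r 1 = 1"
    by (rule polar_reparametrization[OF contour \<open>c > 0\<close>]) (rule that; assumption)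
  interpret transported_level_set "\<lambda>x. f x / L" "\<lambda>x. deriv f x / L" "damping \<kappa>" "momentum \<kappa>" "1 / \<kappa>" \<phi> \<rho> c R
    by unfold_locales (use \<rho> assms(11) \<open>c > 0\<close> in \<open>simp_all add: dyn\<close>)
  have step: "discrete_step f L \<kappa> Ts = euler_step Ts"
    by (simp only: fun_eq_iff discrete_step_def euler_step_def Let_def split_paired_All prod.case force_eq fst_conv snd_conv simp_thms)
  have "signed_area (discrete_step f L \<kappa> Ts \<circ> \<gamma>)
      = area 0 - Ts * (2 * damping \<kappa> * area 0 + momentum \<kappa> * sheared_area 0)"
    unfolding step by (rule signed_area_euler_step[OF r])
  also have "\<dots> < area Ts" by (rule area_contraction[OF \<open>Ts > 0\<close>])
  also have "\<dots> = signed_area (\<phi> Ts \<circ> \<gamma>)"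
    by (rule signed_area_flow[OF r less_imp_le[OF \<open>Ts > 0\<close>], symmetric])
  finally show ?thesis by simp
qed

end
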